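(* Let $(A,\rho,[\cdot,\cdot])$ be a Lie algebroid over $M$ and let $\omega_1,\omega_2,\omega_3\in\Gamma(\bigwedge^2A^* )$ be symplectic forms with inverse Poisson bivectors $\pi_1,\pi_2,\pi_3$ and transition $(1,1)$-tensors $N_i=\pi_{i-1}^\sharp\circ\omega_{i+1}^\flat$ (indices in $\mathbb{Z}_3$). Let $\boldsymbol\varepsilon=(\varepsilon_1,\varepsilon_2,\varepsilon_3)$ be $(-1,-1,-1)$ (hyper case) or $(1,1,-1)$ (para-hyper case), and let $g^\flat:=\varepsilon_3\varepsilon_2\,\omega_3^\flat\circ\pi_1^\sharp\circ\omega_2^\flat:A\to A^*$. (1) In the hyper case, $(\omega_1,\omega_2,\omega_3)$ is a hypersymplectic structure on $A$ if and only if $(g^\flat,N_1,N_2,N_3)$ is a hyperkähler structure on $A$. (2) In the para-hyper case, $(\omega_1,\omega_2,\omega_3)$ is a para-hypersymplectic structure on $A$ if and only if $(g^\flat,N_1,N_2,N_3)$ is a para-hyperkähler structure on $A$.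
   Context: Let $\mathrm d$ denote the differential of the Lie algebroid on $\Gamma(\bigwedge^\bullet A^* )$. A symplectic form on $A$ is a non-degenerate $\omega\in\Gamma(\bigwedge^2A^* )$ with $\mathrm d\omega=0$. For a $2$-form $\omega$, $\omega^\flat:A\to A^*$ is given by $\langle\omega^\flat(X),Y\rangle=\omega(X,Y)$; for a bivector $\pi\in\Gamma(\bigwedge^2A)$, $\pi^\sharp:A^*\to A$ is given by $\langle\beta,\pi^\sharp(\alpha)\rangle=\pi(\alpha,\beta)$. The inverse Poisson bivector $\pi$ of a symplectic form $\omega$ is the bivector with $\omega^\flat\circ\pi^\sharp=\mathrm{Id}_{A^*}$ and $\pi^\sharp\circ\omega^\flat=\mathrm{Id}_A$. Indices are taken in $\mathbb{Z}_3=\{1,2,3\}$. The triple of symplectic forms is a hypersymplectic structure if $N_1^2=N_2^2=N_3^2=-\mathrm{Id}_A$, and a para-hypersymplectic structure (in the normalized form always used) if $N_1^2=N_2^2=\mathrm{Id}_A$ and $N_3^2=-\mathrm{Id}_A$. The Nijenhuis torsion of a bundle endomorphism $N$ of $A$ is $\mathcal TN(X,Y)=[NX,NY]-N([NX,Y]+[X,NY]-N[X,Y])$. A complex (resp. para-complex) tensor is a bundle endomorphism $I$ of $A$ with $I^2=-\mathrm{Id}_A$ (resp. $I^2=\mathrm{Id}_A$) and $\mathcal TI=0$. A metric (positivity is not required, i.e. pseudo-metric) is a $C^\infty(M)$-linear map $\mathtt g:\Gamma(A)\to\Gamma(A^* )$ that is symmetric and non-degenerate. A hermitian (resp. para-hermitian)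 structure is a pair $(\mathtt g,I)$ with $\mathtt g$ a metric and $I$ a complex (resp. para-complex) tensor such that $\langle\mathtt g(IX),IY\rangle=-\langle\mathtt g(X),I^2Y\rangle$ for all $X,Y\in\Gamma(A)$, equivalently $\mathtt g\circ I+I^*\circ\mathtt g=0$ ($I^*$ the transpose). A hyperkähler (resp. para-hyperkähler) structure on $A$ is a quadruple $(\mathtt g,I_1,I_2,I_3)$ such that $(\mathtt g,I_1)$ and $(\mathtt g,I_2)$ are both hermitian (resp. para-hermitian) structures, $I_1I_2=-I_2I_1$, $I_3=I_1I_2$, and for $i=1,2,3$ the map $\mathtt g\circ I_i$ is the flat map of a closed $2$-form on $A$. *)

theory Defs
  imports "HOL-Analysis.Analysis"
begin

section \<open>Smooth manifolds\<close>

text \<open>Model spaces are finite-dimensional real inner product spaces rather than instances of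
  \<open>euclidean_space\<close>, because the latter have positive dimension: manifolds of dimension 0 (so that
  Lie algebras are Lie algebroids) and bundles of rank 0 are allowed.\<close>

definition finite_dim :: "'a::real_vector itself \<Rightarrow> bool" where
  "finite_dim _ \<longleftrightarrow> (\<exists>B :: 'a set. finite B \<and> span B = UNIV)"

primrec Ck_on :: "nat \<Rightarrow> 'a::real_normed_vector set \<Rightarrow> ('a \<Rightarrow> 'b::real_normed_vector) \<Rightarrow> bool" where
  "Ck_on 0 S f \<longleftrightarrow> continuous_on S f"
| "Ck_on (Suc k) S f \<longleftrightarrow>
     (\<forall>x\<in>S. f differentiable (at x)) \<and> (\<forall>v. Ck_on k S (\<lambda>x. frechet_derivative f (at x) v))"

text \<open>Only used for open \<open>S\<close> and a finite-dimensional domain, where \<open>Ck_on k\<close> is the usual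
  class \<open>C\<^sup>k\<close>.\<close>

definition smooth_on :: "'a::real_normed_vector set \<Rightarrow> ('a \<Rightarrow> 'b::real_normed_vector) \<Rightarrow> bool" where
  "smooth_on S f \<longleftrightarrow> (\<forall>k. Ck_on k S f)"

text \<open>The points of the manifold are all elements of the type \<open>'m\<close>; a chart is a pair of its
  domain and its coordinate map.\<close>

record ('m, 'e) manifold_data =
  atlas :: "('m set \<times> ('m \<Rightarrow> 'e)) set"

definition smooth_manifold ::
  "('m::{t2_space,second_countable_topology}, 'e::real_inner, 'z) manifold_data_scheme \<Rightarrow> bool" where
  "smooth_manifold M \<longleftrightarrow>
     finite_dim TYPE('e) \<and>
     (\<Union>(U, \<phi>)\<in>atlas M. U) = UNIV \<and>
     (\<forall>(U, \<phi>)\<in>atlas M. open U \<and> open (\<phi> ` U) \<and> homeomorphism U (\<phi> ` U) \<phi> (inv_into U \<phi>)) \<and>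
     (\<forall>(U, \<phi>)\<in>atlas M. \<forall>(V, \<psi>)\<in>atlas M. smooth_on (\<phi> ` (U \<inter> V)) (\<psi> \<circ> inv_into U \<phi>))"

definition smooth_map_on ::
  "('m, 'e::real_normed_vector, 'z) manifold_data_scheme \<Rightarrow> 'm set \<Rightarrow> ('m \<Rightarrow> 'b::real_normed_vector) \<Rightarrow> bool" where
  "smooth_map_on M W f \<longleftrightarrow> (\<forall>(U, \<phi>)\<in>atlas M. smooth_on (\<phi> ` (U \<inter> W)) (f \<circ> inv_into U \<phi>))"

definition smooth_functions ::
  "('m, 'e::real_normed_vector, 'z) manifold_data_scheme \<Rightarrow> ('m \<Rightarrow> real) set" where
  "smooth_functions M = {f. smooth_map_on M UNIV f}"

text \<open>Tangent vectors at \<open>x\<close> are the derivations at \<open>x\<close> of the algebra of smooth functions; the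
  value of a tangent vector on a non-smooth function carries no meaning.\<close>

definition tangent_vector ::
  "('m, 'e::real_normed_vector, 'z) manifold_data_scheme \<Rightarrow> 'm \<Rightarrow> (('m \<Rightarrow> real) \<Rightarrow> real) \<Rightarrow> bool" where
  "tangent_vector M x D \<longleftrightarrow>
     (\<forall>f\<in>smooth_functions M. \<forall>g\<in>smooth_functions M.
        D (\<lambda>y. f y + g y) = D f + D g \<and> D (\<lambda>y. f y * g y) = f x * D g + g x * D f) \<and>
     (\<forall>c. \<forall>f\<in>smooth_functions M. D (\<lambda>y. c * f y) = c * D f)"

section \<open>Vector bundles\<close>

text \<open>A vector bundle is given by its fibres, which are subspaces \<open>fibre E x\<close> of one vector space
  \<open>'v\<close> (so that the total space is the disjoint union \<open>Sigma UNIV (fibre E)\<close>), together with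
  local trivialisations \<open>(U, \<Phi>)\<close>, where \<open>\<Phi> x\<close> is an isomorphism of \<open>fibre E x\<close> onto \<open>'f\<close> for
  \<open>x \<in> U\<close>. The topology and the smooth structure of the total space are those determined by the
  trivialisations; the topology or position of the fibres in \<open>'v\<close> plays no role, so that
  non-trivial bundles are included.\<close>

record ('m, 'e, 'v, 'f) vector_bundle_data = "('m, 'e) manifold_data" +
  fibre :: "'m \<Rightarrow> 'v set"
  trivs :: "('m set \<times> ('m \<Rightarrow> 'v \<Rightarrow> 'f)) set"

definition linear_on :: "'a::real_vector set \<Rightarrow> ('a \<Rightarrow> 'b::real_vector) \<Rightarrow> bool" where
  "linear_on S f \<longleftrightarrow>
     (\<forall>u\<in>S. \<forall>v\<in>S. f (u + v) = f u + f v) \<and> (\<forall>c. \<forall>u\<in>S. f (c *\<^sub>R u) = c *\<^sub>R f u)"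

text \<open>The vector in the fibre over \<open>x\<close> with coordinate vector \<open>u\<close> in the trivialisation \<open>\<Phi>\<close>; for
  fixed \<open>u\<close> this is a smooth section over the domain of \<open>\<Phi>\<close>, constant in that trivialisation.\<close>

definition frame ::
  "('m, 'e, 'v, 'f, 'z) vector_bundle_data_scheme \<Rightarrow> ('m \<Rightarrow> 'v \<Rightarrow> 'f) \<Rightarrow> 'f \<Rightarrow> 'm \<Rightarrow> 'v" where
  "frame E \<Phi> u x = inv_into (fibre E x) (\<Phi> x) u"

definition vector_bundle ::
  "('m::{t2_space,second_countable_topology}, 'e::real_inner, 'v::real_vector, 'f::real_inner, 'z)
     vector_bundle_data_scheme \<Rightarrow> bool" where
  "vector_bundle E \<longleftrightarrow>
     smooth_manifold E \<and> finite_dim TYPE('f) \<and>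
     (\<forall>x. subspace (fibre E x)) \<and>
     (\<Union>(U, \<Phi>)\<in>trivs E. U) = UNIV \<and>
     (\<forall>(U, \<Phi>)\<in>trivs E. open U \<and>
        (\<forall>x\<in>U. linear_on (fibre E x) (\<Phi> x) \<and> bij_betw (\<Phi> x) (fibre E x) UNIV)) \<and>
     (\<forall>(U, \<Phi>)\<in>trivs E. \<forall>(V, \<Psi>)\<in>trivs E. \<forall>u.
        smooth_map_on E (U \<inter> V) (\<lambda>x. \<Psi> x (frame E \<Phi> u x)))"

definition sections ::
  "('m, 'e::real_normed_vector, 'v, 'f::real_normed_vector, 'z) vector_bundle_data_scheme
     \<Rightarrow> ('m \<Rightarrow> 'v) set" where
  "sections E = {X. (\<forall>x. X x \<in> fibre E x) \<and> (\<forall>(U, \<Phi>)\<in>trivs E. smooth_map_on E U (\<lambda>x. \<Phi> x (X x)))}"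

text \<open>Covectors are extended by 0 outside the fibre, so that equality of covectors is equality of
  functions.\<close>

definition dual_fibre ::
  "('m, 'e, 'v::real_vector, 'f, 'z) vector_bundle_data_scheme \<Rightarrow> 'm \<Rightarrow> ('v \<Rightarrow> real) set" where
  "dual_fibre E x = {\<alpha>. linear_on (fibre E x) \<alpha> \<and> (\<forall>v. v \<notin> fibre E x \<longrightarrow> \<alpha> v = 0)}"

definition coframe ::
  "('m, 'e, 'v, 'f, 'z) vector_bundle_data_scheme \<Rightarrow> ('m \<Rightarrow> 'v \<Rightarrow> 'f) \<Rightarrow> ('f \<Rightarrow> real) \<Rightarrow> 'm \<Rightarrow> 'v \<Rightarrow> real" where
  "coframe E \<Phi> \<xi> x = (\<lambda>v. if v \<in> fibre E x then \<xi> (\<Phi> x v) else 0)"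

text \<open>Tensor fields are given pointwise by multilinear maps on the fibres, and smoothness means
  smoothness of the components in all local trivialisations. Bundle maps \<open>E \<rightarrow> E\<close> and \<open>E \<rightarrow> E\<^sup>*\<close>
  over the identity are the same as \<open>C\<^sup>\<infinity>(M)\<close>-linear maps between the spaces of sections. The
  values of endomorphisms and forms on vectors outside the fibres carry no meaning.\<close>

definition bundle_endo ::
  "('m, 'e::real_normed_vector, 'v::real_vector, 'f::real_normed_vector, 'z) vector_bundle_data_scheme
     \<Rightarrow> ('m \<Rightarrow> 'v \<Rightarrow> 'v) \<Rightarrow> bool" where
  "bundle_endo E N \<longleftrightarrow>
     (\<forall>x. linear_on (fibre E x) (N x) \<and> (\<forall>v\<in>fibre E x. N x v \<in> fibre E x)) \<and>
     (\<forall>(U, \<Phi>)\<in>trivs E. \<forall>u. smooth_map_on E U (\<lambda>x. \<Phi> x (N x (frame E \<Phi> u x))))"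

definition dual_map ::
  "('m, 'e::real_normed_vector, 'v::real_vector, 'f, 'z) vector_bundle_data_scheme
     \<Rightarrow> ('m \<Rightarrow> 'v \<Rightarrow> 'v \<Rightarrow> real) \<Rightarrow> bool" where
  "dual_map E g \<longleftrightarrow>
     (\<forall>x. (\<forall>v\<in>fibre E x. g x v \<in> dual_fibre E x) \<and>
          (\<forall>w\<in>fibre E x. linear_on (fibre E x) (\<lambda>v. g x v w))) \<and>
     (\<forall>(U, \<Phi>)\<in>trivs E. \<forall>u w. smooth_map_on E U (\<lambda>x. g x (frame E \<Phi> u x) (frame E \<Phi> w x)))"

definition two_form ::
  "('m, 'e::real_normed_vector, 'v::real_vector, 'f, 'z) vector_bundle_data_scheme
     \<Rightarrow> ('m \<Rightarrow> 'v \<Rightarrow> 'v \<Rightarrow> real) \<Rightarrow> bool" where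
  "two_form E \<omega> \<longleftrightarrow>
     (\<forall>x. \<forall>v\<in>fibre E x. linear_on (fibre E x) (\<lambda>u. \<omega> x u v) \<and>
        (\<forall>u\<in>fibre E x. \<omega> x u v = - \<omega> x v u)) \<and>
     (\<forall>(U, \<Phi>)\<in>trivs E. \<forall>u w. smooth_map_on E U (\<lambda>x. \<omega> x (frame E \<Phi> u x) (frame E \<Phi> w x)))"

text \<open>Elements of the second exterior power of a fibre are identified with skew-symmetric bilinear
  forms on the dual fibre.\<close>

definition bivector ::
  "('m, 'e::real_normed_vector, 'v::real_vector, 'f::real_normed_vector, 'z) vector_bundle_data_scheme
     \<Rightarrow> ('m \<Rightarrow> ('v \<Rightarrow> real) \<Rightarrow> ('v \<Rightarrow> real) \<Rightarrow> real) \<Rightarrow> bool" where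
  "bivector E \<pi> \<longleftrightarrow>
     (\<forall>x. \<forall>\<alpha>\<in>dual_fibre E x. \<forall>\<beta>\<in>dual_fibre E x.
        \<pi> x \<alpha> \<beta> = - \<pi> x \<beta> \<alpha> \<and>
        (\<forall>\<gamma>\<in>dual_fibre E x. \<pi> x (\<lambda>v. \<alpha> v + \<gamma> v) \<beta> = \<pi> x \<alpha> \<beta> + \<pi> x \<gamma> \<beta>) \<and>
        (\<forall>c. \<pi> x (\<lambda>v. c * \<alpha> v) \<beta> = c * \<pi> x \<alpha> \<beta>)) \<and>
     (\<forall>(U, \<Phi>)\<in>trivs E. \<forall>\<xi> \<eta>. linear \<xi> \<longrightarrow> linear \<eta> \<longrightarrow>
        smooth_map_on E U (\<lambda>x. \<pi> x (coframe E \<Phi> \<xi> x) (coframe E \<Phi> \<eta> x)))"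

definition flat ::
  "('m, 'e, 'v, 'f, 'z) vector_bundle_data_scheme \<Rightarrow> ('m \<Rightarrow> 'v \<Rightarrow> 'v \<Rightarrow> real)
     \<Rightarrow> 'm \<Rightarrow> 'v \<Rightarrow> 'v \<Rightarrow> real" where
  "flat E \<omega> x v = (\<lambda>w. if w \<in> fibre E x then \<omega> x v w else 0)"

text \<open>Existence and uniqueness of \<open>sharp E \<pi> x \<alpha>\<close> is the reflexivity of the finite-dimensional
  fibre.\<close>

definition sharp ::
  "('m, 'e, 'v::real_vector, 'f, 'z) vector_bundle_data_scheme
     \<Rightarrow> ('m \<Rightarrow> ('v \<Rightarrow> real) \<Rightarrow> ('v \<Rightarrow> real) \<Rightarrow> real) \<Rightarrow> 'm \<Rightarrow> ('v \<Rightarrow> real) \<Rightarrow> 'v" where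
  "sharp E \<pi> x \<alpha> = (THE v. v \<in> fibre E x \<and> (\<forall>\<beta>\<in>dual_fibre E x. \<beta> v = \<pi> x \<alpha> \<beta>))"

section \<open>Lie algebroids\<close>

text \<open>The anchor is a bundle map to the tangent bundle; \<open>anchor A x v f\<close> is the derivative of the
  function \<open>f\<close> along the tangent vector \<open>\<rho>(v)\<close> at \<open>x\<close>. The bracket is meaningful on sections only.
  That the anchor preserves brackets follows from the Jacobi identity and the Leibniz rule.\<close>

record ('m, 'e, 'v, 'f) lie_algebroid_data = "('m, 'e, 'v, 'f) vector_bundle_data" +
  anchor :: "'m \<Rightarrow> 'v \<Rightarrow> ('m \<Rightarrow> real) \<Rightarrow> real"
  bracket :: "('m \<Rightarrow> 'v) \<Rightarrow> ('m \<Rightarrow> 'v) \<Rightarrow> ('m \<Rightarrow> 'v)"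

definition anchor_map ::
  "('m, 'e::real_normed_vector, 'v::real_vector, 'f, 'z) lie_algebroid_data_scheme \<Rightarrow> bool" where
  "anchor_map A \<longleftrightarrow>
     (\<forall>x. (\<forall>v\<in>fibre A x. tangent_vector A x (anchor A x v)) \<and>
          (\<forall>f\<in>smooth_functions A. linear_on (fibre A x) (\<lambda>v. anchor A x v f))) \<and>
     (\<forall>(U, \<Phi>)\<in>trivs A. \<forall>u. \<forall>f\<in>smooth_functions A.
        smooth_map_on A U (\<lambda>x. anchor A x (frame A \<Phi> u x) f))"

definition lie_algebroid ::
  "('m::{t2_space,second_countable_topology}, 'e::real_inner, 'v::real_vector, 'f::real_inner, 'z)
     lie_algebroid_data_scheme \<Rightarrow> bool" where
  "lie_algebroid A \<longleftrightarrow>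
     vector_bundle A \<and> anchor_map A \<and>
     (\<forall>X\<in>sections A. \<forall>Y\<in>sections A.
        bracket A X Y \<in> sections A \<and>
        bracket A X Y = (\<lambda>x. - bracket A Y X x) \<and>
        (\<forall>c. bracket A (\<lambda>x. c *\<^sub>R X x) Y = (\<lambda>x. c *\<^sub>R bracket A X Y x)) \<and>
        (\<forall>f\<in>smooth_functions A.
           bracket A X (\<lambda>x. f x *\<^sub>R Y x) =
             (\<lambda>x. f x *\<^sub>R bracket A X Y x + anchor A x (X x) f *\<^sub>R Y x))) \<and>
     (\<forall>X\<in>sections A. \<forall>Y\<in>sections A. \<forall>Z\<in>sections A.
        bracket A (\<lambda>x. X x + Y x) Z = (\<lambda>x. bracket A X Z x + bracket A Y Z x) \<and>
        (\<forall>x. bracket A X (bracket A Y Z) x + bracket A Y (bracket A Z X) x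
             + bracket A Z (bracket A X Y) x = 0))"

text \<open>The Lie algebroid differential of a 2-form (Koszul formula), evaluated on sections.\<close>

definition d_two_form ::
  "('m, 'e, 'v, 'f, 'z) lie_algebroid_data_scheme \<Rightarrow> ('m \<Rightarrow> 'v \<Rightarrow> 'v \<Rightarrow> real)
     \<Rightarrow> ('m \<Rightarrow> 'v) \<Rightarrow> ('m \<Rightarrow> 'v) \<Rightarrow> ('m \<Rightarrow> 'v) \<Rightarrow> 'm \<Rightarrow> real" where
  "d_two_form A \<omega> X Y Z x =
     anchor A x (X x) (\<lambda>y. \<omega> y (Y y) (Z y))
     - anchor A x (Y x) (\<lambda>y. \<omega> y (X y) (Z y))
     + anchor A x (Z x) (\<lambda>y. \<omega> y (X y) (Y y))
     - \<omega> x (bracket A X Y x) (Z x)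
     + \<omega> x (bracket A X Z x) (Y x)
     - \<omega> x (bracket A Y Z x) (X x)"

definition closed_two_form ::
  "('m, 'e::real_normed_vector, 'v::real_vector, 'f::real_normed_vector, 'z) lie_algebroid_data_scheme
     \<Rightarrow> ('m \<Rightarrow> 'v \<Rightarrow> 'v \<Rightarrow> real) \<Rightarrow> bool" where
  "closed_two_form A \<omega> \<longleftrightarrow> two_form A \<omega> \<and>
     (\<forall>X\<in>sections A. \<forall>Y\<in>sections A. \<forall>Z\<in>sections A. \<forall>x. d_two_form A \<omega> X Y Z x = 0)"

definition nondegenerate ::
  "('m, 'e, 'v::zero, 'f, 'z) vector_bundle_data_scheme \<Rightarrow> ('m \<Rightarrow> 'v \<Rightarrow> 'v \<Rightarrow> real) \<Rightarrow> bool" where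
  "nondegenerate E b \<longleftrightarrow> (\<forall>x. \<forall>v\<in>fibre E x. (\<forall>w\<in>fibre E x. b x v w = 0) \<longrightarrow> v = 0)"

definition symplectic ::
  "('m, 'e::real_normed_vector, 'v::real_vector, 'f::real_normed_vector, 'z) lie_algebroid_data_scheme
     \<Rightarrow> ('m \<Rightarrow> 'v \<Rightarrow> 'v \<Rightarrow> real) \<Rightarrow> bool" where
  "symplectic A \<omega> \<longleftrightarrow> closed_two_form A \<omega> \<and> nondegenerate A \<omega>"

definition inverse_bivector ::
  "('m, 'e::real_normed_vector, 'v::real_vector, 'f::real_normed_vector, 'z) lie_algebroid_data_scheme
     \<Rightarrow> ('m \<Rightarrow> 'v \<Rightarrow> 'v \<Rightarrow> real) \<Rightarrow> ('m \<Rightarrow> ('v \<Rightarrow> real) \<Rightarrow> ('v \<Rightarrow> real) \<Rightarrow> real) \<Rightarrow> bool" where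
  "inverse_bivector A \<omega> \<pi> \<longleftrightarrow> bivector A \<pi> \<and>
     (\<forall>x. (\<forall>\<alpha>\<in>dual_fibre A x. flat A \<omega> x (sharp A \<pi> x \<alpha>) = \<alpha>) \<and>
          (\<forall>v\<in>fibre A x. sharp A \<pi> x (flat A \<omega> x v) = v))"

section \<open>Nijenhuis torsion, hermitian and hyper-Kaehler structures\<close>

definition torsion ::
  "('m, 'e, 'v::real_vector, 'f, 'z) lie_algebroid_data_scheme \<Rightarrow> ('m \<Rightarrow> 'v \<Rightarrow> 'v)
     \<Rightarrow> ('m \<Rightarrow> 'v) \<Rightarrow> ('m \<Rightarrow> 'v) \<Rightarrow> 'm \<Rightarrow> 'v" where
  "torsion A N X Y x =
     bracket A (\<lambda>y. N y (X y)) (\<lambda>y. N y (Y y)) x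
     - N x (bracket A (\<lambda>y. N y (X y)) Y x + bracket A X (\<lambda>y. N y (Y y)) x
            - N x (bracket A X Y x))"

text \<open>In what follows a sign \<open>s\<close> distinguishes the complex, hermitian, hyper (\<open>s = - 1\<close>) from the
  para-complex, para-hermitian, para-hyper (\<open>s = 1\<close>) notions.\<close>

definition squares_to ::
  "('m, 'e, 'v::real_vector, 'f, 'z) vector_bundle_data_scheme \<Rightarrow> real \<Rightarrow> ('m \<Rightarrow> 'v \<Rightarrow> 'v) \<Rightarrow> bool" where
  "squares_to E s N \<longleftrightarrow> (\<forall>x. \<forall>v\<in>fibre E x. N x (N x v) = s *\<^sub>R v)"

definition complex_tensor ::
  "('m, 'e::real_normed_vector, 'v::real_vector, 'f::real_normed_vector, 'z) lie_algebroid_data_scheme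
     \<Rightarrow> real \<Rightarrow> ('m \<Rightarrow> 'v \<Rightarrow> 'v) \<Rightarrow> bool" where
  "complex_tensor A s J \<longleftrightarrow> bundle_endo A J \<and> squares_to A s J \<and>
     (\<forall>X\<in>sections A. \<forall>Y\<in>sections A. \<forall>x. torsion A J X Y x = 0)"

definition pseudo_metric ::
  "('m, 'e::real_normed_vector, 'v::real_vector, 'f, 'z) vector_bundle_data_scheme
     \<Rightarrow> ('m \<Rightarrow> 'v \<Rightarrow> 'v \<Rightarrow> real) \<Rightarrow> bool" where
  "pseudo_metric E g \<longleftrightarrow> dual_map E g \<and> nondegenerate E g \<and>
     (\<forall>x. \<forall>v\<in>fibre E x. \<forall>w\<in>fibre E x. g x v w = g x w v)"

definition hermitian ::
  "('m, 'e::real_normed_vector, 'v::real_vector, 'f::real_normed_vector, 'z) lie_algebroid_data_scheme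
     \<Rightarrow> real \<Rightarrow> ('m \<Rightarrow> 'v \<Rightarrow> 'v \<Rightarrow> real) \<Rightarrow> ('m \<Rightarrow> 'v \<Rightarrow> 'v) \<Rightarrow> bool" where
  "hermitian A s g J \<longleftrightarrow> pseudo_metric A g \<and> complex_tensor A s J \<and>
     (\<forall>X\<in>sections A. \<forall>Y\<in>sections A. \<forall>x.
        g x (J x (X x)) (J x (Y x)) = - g x (X x) (J x (J x (Y x))))"

definition hyperkahler_sgn ::
  "('m, 'e::real_normed_vector, 'v::real_vector, 'f::real_normed_vector, 'z) lie_algebroid_data_scheme
     \<Rightarrow> real \<Rightarrow> ('m \<Rightarrow> 'v \<Rightarrow> 'v \<Rightarrow> real)
     \<Rightarrow> ('m \<Rightarrow> 'v \<Rightarrow> 'v) \<Rightarrow> ('m \<Rightarrow> 'v \<Rightarrow> 'v) \<Rightarrow> ('m \<Rightarrow> 'v \<Rightarrow> 'v) \<Rightarrow> bool" where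
  "hyperkahler_sgn A s g I\<^sub>1 I\<^sub>2 I\<^sub>3 \<longleftrightarrow>
     hermitian A s g I\<^sub>1 \<and> hermitian A s g I\<^sub>2 \<and>
     (\<forall>x. \<forall>v\<in>fibre A x. I\<^sub>1 x (I\<^sub>2 x v) = - I\<^sub>2 x (I\<^sub>1 x v) \<and> I\<^sub>3 x v = I\<^sub>1 x (I\<^sub>2 x v)) \<and>
     (\<forall>J\<in>{I\<^sub>1, I\<^sub>2, I\<^sub>3}. \<exists>\<eta>. closed_two_form A \<eta> \<and>
        (\<forall>x. \<forall>v\<in>fibre A x. g x (J x v) = flat A \<eta> x v))"

abbreviation "hyperkahler A \<equiv> hyperkahler_sgn A (- 1)"
abbreviation "para_hyperkahler A \<equiv> hyperkahler_sgn A 1"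

section \<open>Triples of symplectic forms\<close>

text \<open>Triples are indexed by the type \<open>3\<close> of integers modulo 3, in which \<open>3 = 0\<close>.\<close>

definition transition ::
  "('m, 'e, 'v::real_vector, 'f, 'z) vector_bundle_data_scheme
     \<Rightarrow> (3 \<Rightarrow> 'm \<Rightarrow> 'v \<Rightarrow> 'v \<Rightarrow> real) \<Rightarrow> (3 \<Rightarrow> 'm \<Rightarrow> ('v \<Rightarrow> real) \<Rightarrow> ('v \<Rightarrow> real) \<Rightarrow> real)
     \<Rightarrow> 3 \<Rightarrow> 'm \<Rightarrow> 'v \<Rightarrow> 'v" where
  "transition E \<omega> \<pi> i x v = sharp E (\<pi> (i - 1)) x (flat E (\<omega> (i + 1)) x v)"

definition hyper_sgn :: "3 \<Rightarrow> real" where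
  "hyper_sgn i = - 1"

definition para_hyper_sgn :: "3 \<Rightarrow> real" where
  "para_hyper_sgn i = (if i = 3 then - 1 else 1)"

definition metric_flat ::
  "('m, 'e, 'v::real_vector, 'f, 'z) vector_bundle_data_scheme \<Rightarrow> (3 \<Rightarrow> real)
     \<Rightarrow> (3 \<Rightarrow> 'm \<Rightarrow> 'v \<Rightarrow> 'v \<Rightarrow> real) \<Rightarrow> (3 \<Rightarrow> 'm \<Rightarrow> ('v \<Rightarrow> real) \<Rightarrow> ('v \<Rightarrow> real) \<Rightarrow> real)
     \<Rightarrow> 'm \<Rightarrow> 'v \<Rightarrow> 'v \<Rightarrow> real" where
  "metric_flat E \<epsilon> \<omega> \<pi> x v =
     (\<lambda>w. \<epsilon> 3 * \<epsilon> 2 * flat E (\<omega> 3) x (sharp E (\<pi> 1) x (flat E (\<omega> 2) x v)) w)"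

definition hypersymplectic_sgn ::
  "('m, 'e::real_normed_vector, 'v::real_vector, 'f::real_normed_vector, 'z) lie_algebroid_data_scheme
     \<Rightarrow> (3 \<Rightarrow> real)
     \<Rightarrow> (3 \<Rightarrow> 'm \<Rightarrow> 'v \<Rightarrow> 'v \<Rightarrow> real) \<Rightarrow> (3 \<Rightarrow> 'm \<Rightarrow> ('v \<Rightarrow> real) \<Rightarrow> ('v \<Rightarrow> real) \<Rightarrow> real)
     \<Rightarrow> bool" where
  "hypersymplectic_sgn A \<epsilon> \<omega> \<pi> \<longleftrightarrow>
     (\<forall>i. symplectic A (\<omega> i) \<and> inverse_bivector A (\<omega> i) (\<pi> i)) \<and>
     (\<forall>i. squares_to A (\<epsilon> i) (transition A \<omega> \<pi> i))"

abbreviation "hypersymplectic A \<equiv> hypersymplectic_sgn A hyper_sgn"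
abbreviation "para_hypersymplectic A \<equiv> hypersymplectic_sgn A para_hyper_sgn"

end

theory Submission
  imports Defs
begin

text \<open>The relations \<open>\<omega>\<^sub>3(N\<^sub>1 \<cdot>, \<cdot>) = \<omega>\<^sub>2\<close>, \<open>\<omega>\<^sub>1(N\<^sub>2 \<cdot>, \<cdot>) = \<omega>\<^sub>3\<close>, \<open>\<omega>\<^sub>2(N\<^sub>3 \<cdot>, \<cdot>) = \<omega>\<^sub>1\<close> give
  \<open>N\<^sub>2 N\<^sub>1 N\<^sub>3 = Id\<close>. If \<open>N\<^sub>1\<^sup>2 = N\<^sub>2\<^sup>2 = s\<close> and \<open>N\<^sub>3\<^sup>2 = -1\<close> with \<open>s = \<plusminus>1\<close>, this forces
  \<open>N\<^sub>3 = N\<^sub>1 N\<^sub>2 = - N\<^sub>2 N\<^sub>1\<close>, and \<open>g = s \<omega>\<^sub>3(N\<^sub>3 \<cdot>, \<cdot>)\<close> satisfies \<open>g(N\<^sub>1 \<cdot>, \<cdot>) = - s \<omega>\<^sub>1\<close>, \<open>g(N\<^sub>2 \<cdot>, \<cdot>) = \<omega>\<^sub>2\<close>,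
  \<open>g(N\<^sub>3 \<cdot>, \<cdot>) = - s \<omega>\<^sub>3\<close>; the torsion of \<open>N\<^sub>1\<close> and \<open>N\<^sub>2\<close> vanishes because \<open>N\<close> intertwines two closed
  forms and \<open>N\<^sup>2\<close> is a scalar. Conversely \<open>N\<^sub>1 N\<^sub>2 N\<^sub>1 N\<^sub>2 = - N\<^sub>1\<^sup>2 N\<^sub>2\<^sup>2 = -1\<close>. Since the torsion is only
  tested against sections, bump functions are needed to reach every vector of a fibre.\<close>

section \<open>Calculus of smooth maps\<close>

lemma Ck_on_subset: "Ck_on k S f \<Longrightarrow> T \<subseteq> S \<Longrightarrow> Ck_on k T f"
proof (induction k arbitrary: f)
  case 0
  then show ?case by (auto intro: continuous_on_subset)
next
  case (Suc k)
  then show ?case by auto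
qed

text \<open>Openness turns agreement on \<open>S\<close> into agreement near each of its points, so
  the Frechet derivatives agree on \<open>S\<close> too and the induction can pass to them.\<close>

lemma Ck_on_cong:
  assumes "open S" "\<And>x. x \<in> S \<Longrightarrow> f x = g x" "Ck_on k S f"
  shows "Ck_on k S g"
  using assms(2,3)
proof (induction k arbitrary: f g)
  case 0
  then show ?case by (metis Ck_on.simps(1) continuous_on_cong)
next
  case (Suc k)
  have d: "(g has_derivative frechet_derivative f (at x)) (at x)" if "x \<in> S" for x
    using Suc.prems that \<open>open S\<close> frechet_derivative_works
    by (metis Ck_on.simps(2) has_derivative_transform_within_open)
  have fd: "frechet_derivative f (at x) v = frechet_derivative g (at x) v" if "x \<in> S" for x v
    using d[OF that] by (simp add: frechet_derivative_at[symmetric])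
  have "Ck_on k S (\<lambda>x. frechet_derivative g (at x) v)" for v
    using Suc.IH[of "\<lambda>x. frechet_derivative f (at x) v"] fd Suc.prems(2) by simp
  then show ?case using d by (auto simp: differentiable_def)
qed

lemma Ck_on_Suc_D: "Ck_on (Suc k) S f \<Longrightarrow> Ck_on k S f"
proof (induction k arbitrary: f)
  case 0
  then show ?case
    by (simp add: continuous_at_imp_continuous_on differentiable_imp_continuous_within)
next
  case (Suc k)
  have "Ck_on k S (\<lambda>x. frechet_derivative f (at x) v)" for v
    using Suc.IH Suc.prems unfolding Ck_on.simps(2)[of "Suc k"] by blast
  then show ?case using Suc.prems by simp
qed

text \<open>Gluing. Derivatives are taken in the ambient space, so differentiability is a pointwise
  condition; openness of the pieces enters only through continuity at order 0.\<close>

lemma Ck_on_UN: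
  assumes "\<And>i. i \<in> I \<Longrightarrow> open (S i)" "\<And>i. i \<in> I \<Longrightarrow> Ck_on k (S i) f"
  shows "Ck_on k (\<Union>i\<in>I. S i) f"
  using assms(2)
proof (induction k arbitrary: f)
  case 0
  then show ?case using assms(1) by (auto intro: continuous_on_open_UN)
next
  case (Suc k)
  then show ?case by auto
qed

lemma Ck_on_const: "Ck_on k S (\<lambda>x. c)"
  by (induction k arbitrary: c) (auto simp: frechet_derivative_const)

lemma Ck_on_add:
  assumes "open S" "Ck_on k S f" "Ck_on k S g"
  shows "Ck_on k S (\<lambda>x. f x + g x)"
  using assms(2,3)
proof (induction k arbitrary: f g)
  case 0
  then show ?case by (auto intro: continuous_intros)
next
  case (Suc k)
  have "frechet_derivative (\<lambda>x. f x + g x) (at x) v =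
      frechet_derivative f (at x) v + frechet_derivative g (at x) v" if "x \<in> S" for x v
    using Suc.prems that
    by (intro fun_cong[OF frechet_derivative_at[symmetric]] has_derivative_add)
       (auto simp: frechet_derivative_works[symmetric])
  moreover have "Ck_on k S (\<lambda>x. frechet_derivative f (at x) v + frechet_derivative g (at x) v)" for v
    using Suc.prems by (intro Suc.IH) auto
  ultimately have "Ck_on k S (\<lambda>x. frechet_derivative (\<lambda>x. f x + g x) (at x) v)" for v
    by (intro Ck_on_cong[OF \<open>open S\<close>,
      of "\<lambda>x. frechet_derivative f (at x) v + frechet_derivative g (at x) v"
         "\<lambda>x. frechet_derivative (\<lambda>x. f x + g x) (at x) v"]) simp_all
  then show ?case using Suc.prems by auto
qed

lemma (in bounded_bilinear) Ck_on_bilinear: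
  assumes "open S" "Ck_on k S f" "Ck_on k S g"
  shows "Ck_on k S (\<lambda>x. prod (f x) (g x))"
  using assms(2,3)
proof (induction k arbitrary: f g)
  case 0
  then show ?case by (auto intro: continuous_on)
next
  case (Suc k)
  have d: "((\<lambda>x. prod (f x) (g x)) has_derivative
      (\<lambda>v. prod (f x) (frechet_derivative g (at x) v) + prod (frechet_derivative f (at x) v) (g x)))
      (at x)" if "x \<in> S" for x
    using Suc.prems that by (intro FDERIV) (auto simp: frechet_derivative_works[symmetric])
  have fd: "frechet_derivative (\<lambda>x. prod (f x) (g x)) (at x) v =
      prod (f x) (frechet_derivative g (at x) v) + prod (frechet_derivative f (at x) v) (g x)"
    if "x \<in> S" for x v
    using d[OF that] by (metis frechet_derivative_at)
  \<comment> \<open>The Leibniz rule leaves one factor undifferentiated; it is lowered to order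
    \<open>k\<close> so that the induction hypothesis covers each summand.\<close>
  have fg: "Ck_on k S f" "Ck_on k S g" using Suc.prems Ck_on_Suc_D by blast+
  have dfg: "Ck_on k S (\<lambda>x. frechet_derivative f (at x) v)"
    "Ck_on k S (\<lambda>x. frechet_derivative g (at x) v)" for v
    using Suc.prems by simp_all
  have "Ck_on k S (\<lambda>x. prod (f x) (frechet_derivative g (at x) v) +
      prod (frechet_derivative f (at x) v) (g x))" for v
    by (rule Ck_on_add[OF \<open>open S\<close> Suc.IH[OF fg(1) dfg(2)] Suc.IH[OF dfg(1) fg(2)]])
  then have "Ck_on k S (\<lambda>x. frechet_derivative (\<lambda>x. prod (f x) (g x)) (at x) v)" for v
    by (rule Ck_on_cong[OF \<open>open S\<close>, rotated]) (simp add: fd)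
  then show ?case using d by (auto simp: differentiable_def)
qed

lemma smooth_on_cong:
  "open S \<Longrightarrow> (\<And>x. x \<in> S \<Longrightarrow> f x = g x) \<Longrightarrow> smooth_on S f \<Longrightarrow> smooth_on S g"
  unfolding smooth_on_def using Ck_on_cong by blast

lemma smooth_on_const: "smooth_on S (\<lambda>x. c)"
  unfolding smooth_on_def using Ck_on_const by blast

lemma smooth_on_subset: "smooth_on S f \<Longrightarrow> T \<subseteq> S \<Longrightarrow> smooth_on T f"
  unfolding smooth_on_def using Ck_on_subset by blast

lemma (in bounded_bilinear) smooth_on_bilinear:
  "open S \<Longrightarrow> smooth_on S f \<Longrightarrow> smooth_on S g \<Longrightarrow> smooth_on S (\<lambda>x. prod (f x) (g x))"
  unfolding smooth_on_def using Ck_on_bilinear by blast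

lemma smooth_on_add:
  "open S \<Longrightarrow> smooth_on S f \<Longrightarrow> smooth_on S g \<Longrightarrow> smooth_on S (\<lambda>x. f x + g x)"
  unfolding smooth_on_def using Ck_on_add by blast

section \<open>Smooth maps on open subsets of a manifold, read in charts\<close>

lemma open_chart_image:
  assumes "smooth_manifold M" "(U, \<phi>) \<in> atlas M" "open W"
  shows "open (\<phi> ` (U \<inter> W))"
proof -
  have h: "open (\<phi> ` U)" "homeomorphism U (\<phi> ` U) \<phi> (inv_into U \<phi>)"
    using assms unfolding smooth_manifold_def by fast+
  have "openin (top_of_set U) (U \<inter> W)" using assms(3) by (rule openin_open_Int)
  then have "openin (top_of_set (\<phi> ` U)) (\<phi> ` (U \<inter> W))"
    using h(2) homeomorphism_imp_open_map by blast
  then show ?thesis using h(1) openin_open_trans by blast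
qed

lemma chart_inverse:
  assumes "smooth_manifold M" "(U, \<phi>) \<in> atlas M" "x \<in> U"
  shows "inv_into U \<phi> (\<phi> x) = x"
proof -
  have "homeomorphism U (\<phi> ` U) \<phi> (inv_into U \<phi>)"
    using assms unfolding smooth_manifold_def by fast
  then show ?thesis using assms(3) by (simp add: homeomorphism_def)
qed

lemma smooth_map_on_cong:
  assumes "smooth_manifold M" "open W" "\<And>x. x \<in> W \<Longrightarrow> f x = g x" "smooth_map_on M W f"
  shows "smooth_map_on M W g"
  unfolding smooth_map_on_def
proof (clarify)
  fix U \<phi> assume c: "(U, \<phi>) \<in> atlas M"
  have "smooth_on (\<phi> ` (U \<inter> W)) (f \<circ> inv_into U \<phi>)"
    using assms(4) c unfolding smooth_map_on_def by fast
  then show "smooth_on (\<phi> ` (U \<inter> W)) (g \<circ> inv_into U \<phi>)"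
    by (rule smooth_on_cong[OF open_chart_image[OF assms(1) c assms(2)], rotated])
       (auto simp: chart_inverse[OF assms(1) c] assms(3))
qed

lemma smooth_map_on_subset:
  assumes "smooth_map_on M W f" "V \<subseteq> W"
  shows "smooth_map_on M V f"
  unfolding smooth_map_on_def
proof clarify
  fix U \<phi> assume "(U, \<phi>) \<in> atlas M"
  then have "smooth_on (\<phi> ` (U \<inter> W)) (f \<circ> inv_into U \<phi>)"
    using assms(1) unfolding smooth_map_on_def by fast
  then show "smooth_on (\<phi> ` (U \<inter> V)) (f \<circ> inv_into U \<phi>)"
    by (rule smooth_on_subset) (use assms(2) in auto)
qed

text \<open>Smoothness may be checked on the pieces of an open cover; functions and sections
  extended by zero are treated this way.\<close>

lemma smooth_map_on_UN:
  assumes "smooth_manifold M" "\<And>i. i \<in> I \<Longrightarrow> open (W i)"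
    "\<And>i. i \<in> I \<Longrightarrow> smooth_map_on M (W i) f"
  shows "smooth_map_on M (\<Union>i\<in>I. W i) f"
  unfolding smooth_map_on_def
proof clarify
  fix U \<phi> assume c: "(U, \<phi>) \<in> atlas M"
  have "smooth_on (\<phi> ` (U \<inter> W i)) (f \<circ> inv_into U \<phi>)" if "i \<in> I" for i
    using assms(3)[OF that] c unfolding smooth_map_on_def by fast
  then have "smooth_on (\<Union>i\<in>I. \<phi> ` (U \<inter> W i)) (f \<circ> inv_into U \<phi>)"
    using open_chart_image[OF assms(1) c assms(2)] unfolding smooth_on_def
    by (intro allI Ck_on_UN) auto
  moreover have "\<phi> ` (U \<inter> (\<Union>i\<in>I. W i)) = (\<Union>i\<in>I. \<phi> ` (U \<inter> W i))" by blast
  ultimately show "smooth_on (\<phi> ` (U \<inter> (\<Union>i\<in>I. W i))) (f \<circ> inv_into U \<phi>)" by simp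
qed

lemma smooth_map_on_const: "smooth_map_on M W (\<lambda>x. c)"
  unfolding smooth_map_on_def comp_def using smooth_on_const by fast

lemma (in bounded_bilinear) smooth_map_on_bilinear:
  assumes "smooth_manifold M" "open W" "smooth_map_on M W f" "smooth_map_on M W g"
  shows "smooth_map_on M W (\<lambda>x. prod (f x) (g x))"
  using assms(3,4) unfolding smooth_map_on_def comp_def
  by (auto intro!: smooth_on_bilinear open_chart_image[OF assms(1) _ assms(2)])

lemmas smooth_map_on_mult = bounded_bilinear.smooth_map_on_bilinear[OF bounded_bilinear_mult]
lemmas smooth_map_on_scaleR = bounded_bilinear.smooth_map_on_bilinear[OF bounded_bilinear_scaleR]
lemmas smooth_map_on_inner = bounded_bilinear.smooth_map_on_bilinear[OF bounded_bilinear_inner]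

lemma smooth_map_on_add:
  assumes "smooth_manifold M" "open W" "smooth_map_on M W f" "smooth_map_on M W g"
  shows "smooth_map_on M W (\<lambda>x. f x + g x)"
  using assms(3,4) unfolding smooth_map_on_def comp_def
  by (auto intro!: smooth_on_add open_chart_image[OF assms(1) _ assms(2)])

lemma smooth_map_on_sum:
  assumes "smooth_manifold M" "open W" "\<And>i. i \<in> I \<Longrightarrow> smooth_map_on M W (f i)"
  shows "smooth_map_on M W (\<lambda>x. \<Sum>i\<in>I. f i x)"
  using assms(3)
  by (induction I rule: infinite_finite_induct)
     (auto intro: smooth_map_on_const smooth_map_on_add[OF assms(1,2)])

section \<open>Finite-dimensional inner product spaces\<close>

text \<open>Encoded by the expansion formula, the form in which it is used. Pairwise orthogonality
  is implied: pairing the expansion of a member \<open>b\<close> with \<open>b\<close> gives 1 = 1 +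
  the sum of the squared inner products of \<open>b\<close> with the other members.\<close>

definition orthonormal_basis :: "'a::real_inner set \<Rightarrow> bool" where
  "orthonormal_basis B \<longleftrightarrow> finite B \<and> (\<forall>x. (\<Sum>b\<in>B. (x \<bullet> b) *\<^sub>R b) = x) \<and> (\<forall>b\<in>B. norm b = 1)"

text \<open>Gram-Schmidt, one vector at a time. That the vectors of \<open>B\<close> equal their
  expansions in \<open>C\<close> takes the place of a statement about spans.\<close>

lemma orthonormal_extension:
  fixes B :: "'a::real_inner set"
  assumes "finite B"
  shows "\<exists>C. finite C \<and> (\<forall>c\<in>C. \<forall>d\<in>C. c \<bullet> d = (if c = d then 1 else 0)) \<and>
    (\<forall>x\<in>B. (\<Sum>c\<in>C. (x \<bullet> c) *\<^sub>R c) = x)"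
  using assms
proof (induction B)
  case empty
  show ?case by (intro exI[of _ "{}"]) auto
next
  case (insert b B)
  then obtain C where C: "finite C" "\<And>c d. c \<in> C \<Longrightarrow> d \<in> C \<Longrightarrow> c \<bullet> d = (if c = d then 1 else 0)"
    "\<And>x. x \<in> B \<Longrightarrow> (\<Sum>c\<in>C. (x \<bullet> c) *\<^sub>R c) = x" by blast
  define w where "w = b - (\<Sum>c\<in>C. (b \<bullet> c) *\<^sub>R c)"
  have wC: "w \<bullet> d = 0" if "d \<in> C" for d
  proof -
    have "(\<Sum>c\<in>C. (b \<bullet> c) * (c \<bullet> d)) = (\<Sum>c\<in>C. if c = d then b \<bullet> d else 0)"
      using C(2) that by (intro sum.cong) auto
    then show ?thesis
      using that C(1) by (simp add: w_def inner_diff_left inner_sum_left)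
  qed
  show ?case
  \<comment> \<open>A vanishing remainder \<open>w\<close> means that \<open>b\<close> already
    expands in \<open>C\<close>, and nothing is added.\<close>
  proof (cases "w = 0")
    case True
    then show ?thesis using C w_def by (intro exI[of _ C]) auto
  next
    case False
    define u where "u = (1 / norm w) *\<^sub>R w"
    have u: "u \<bullet> u = 1" "\<And>c. c \<in> C \<Longrightarrow> u \<bullet> c = 0" "\<And>c. c \<in> C \<Longrightarrow> c \<bullet> u = 0"
      using False wC by (auto simp: u_def dot_square_norm power2_eq_square inner_commute)
    have "u \<notin> C" using u by fastforce
    \<comment> \<open>The earlier vectors are combinations of \<open>C\<close>, which is orthogonal
      to \<open>u\<close>, so the new term in their expansions is zero.\<close>
    have "x \<bullet> u = 0" if "x \<in> B" for x
    proof -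
      have "x \<bullet> u = (\<Sum>c\<in>C. (x \<bullet> c) *\<^sub>R c) \<bullet> u" using C(3)[OF that] by simp
      then show ?thesis using u by (simp add: inner_sum_left)
    qed
    moreover have "b \<bullet> u = norm w"
    proof -
      have "b \<bullet> u = w \<bullet> u + (\<Sum>c\<in>C. (b \<bullet> c) *\<^sub>R c) \<bullet> u"
        by (simp add: w_def inner_diff_left)
      then show ?thesis using u False
        by (simp add: inner_sum_left u_def dot_square_norm power2_eq_square)
    qed
    then have "(b \<bullet> u) *\<^sub>R u + (\<Sum>c\<in>C. (b \<bullet> c) *\<^sub>R c) = b"
      using False by (simp add: u_def w_def)
    ultimately show ?thesis
      using C u \<open>u \<notin> C\<close> by (intro exI[of _ "insert u C"]) auto
  qed
qed

lemma exists_orthonormal_basis: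
  assumes "finite_dim TYPE('a::real_inner)"
  shows "\<exists>B :: 'a set. orthonormal_basis B"
proof -
  obtain B :: "'a set" where B: "finite B" "span B = UNIV"
    using assms unfolding finite_dim_def by blast
  obtain C where C: "finite C" "\<And>c d. c \<in> C \<Longrightarrow> d \<in> C \<Longrightarrow> c \<bullet> d = (if c = d then 1 else 0)"
    "\<And>x. x \<in> B \<Longrightarrow> (\<Sum>c\<in>C. (x \<bullet> c) *\<^sub>R c) = x" using orthonormal_extension[OF B(1)] by blast
  \<comment> \<open>The vectors equal to their expansion form a subspace, so it is enough that it
    contains a spanning set.\<close>
  have "subspace {x. (\<Sum>c\<in>C. (x \<bullet> c) *\<^sub>R c) = x}"
    by (auto simp: subspace_def inner_add_left scaleR_add_left sum.distrib
        scaleR_sum_right[symmetric] simp flip: scaleR_scaleR)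
  then have "span B \<subseteq> {x. (\<Sum>c\<in>C. (x \<bullet> c) *\<^sub>R c) = x}"
    using C(3) by (intro span_minimal) auto
  then show ?thesis
    using B C(1,2) unfolding orthonormal_basis_def norm_eq_sqrt_inner by (intro exI[of _ C]) auto
qed

text \<open>The ball is a closed part of a box, and the box is a finite sum of compact segments
  along an orthonormal basis.\<close>

lemma compact_cball_finite_dim:
  fixes a :: "'a::real_inner"
  assumes "finite_dim TYPE('a)"
  shows "compact (cball a r)"
proof -
  obtain B :: "'a set" where B: "orthonormal_basis B" using exists_orthonormal_basis[OF assms] by blast
  have fin: "finite B" and nb: "\<And>b. b \<in> B \<Longrightarrow> norm b = 1"
    and ex: "\<And>x. (\<Sum>b\<in>B. (x \<bullet> b) *\<^sub>R b) = x"
    using B unfolding orthonormal_basis_def by auto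
  \<comment> \<open>The box grows by one direction at a time, hence the claim for every finite set
    of directions.\<close>
  have "compact {\<Sum>b\<in>C. c b *\<^sub>R b |c. \<forall>b\<in>C. \<bar>c b\<bar> \<le> r}" if "finite C" for C :: "'a set"
    using that
  proof (induction C)
    case empty
    then show ?case by simp
  next
    case (insert d C)
    let ?K = "\<lambda>C. {\<Sum>b\<in>C. c b *\<^sub>R b |c. \<forall>b\<in>C. \<bar>c b\<bar> \<le> r}"
    have "compact ((\<lambda>t. t *\<^sub>R d) ` {-r..r})"
      by (intro compact_continuous_image continuous_intros) auto
    then have "compact {x + y |x y. x \<in> (\<lambda>t. t *\<^sub>R d) ` {-r..r} \<and> y \<in> ?K C}"
      using insert by (intro compact_sums) auto
    also have "{x + y |x y. x \<in> (\<lambda>t. t *\<^sub>R d) ` {-r..r} \<and> y \<in> ?K C} = ?K (insert d C)"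
    proof (intro equalityI subsetI)
      fix z assume "z \<in> {x + y |x y. x \<in> (\<lambda>t. t *\<^sub>R d) ` {-r..r} \<and> y \<in> ?K C}"
      then obtain t c where tc: "z = t *\<^sub>R d + (\<Sum>b\<in>C. c b *\<^sub>R b)" "-r \<le> t" "t \<le> r"
        "\<forall>b\<in>C. \<bar>c b\<bar> \<le> r" by auto
      have "(\<Sum>b\<in>C. (c(d := t)) b *\<^sub>R b) = (\<Sum>b\<in>C. c b *\<^sub>R b)"
        using insert(2) by (intro sum.cong) auto
      then have "z = (\<Sum>b\<in>insert d C. (c(d := t)) b *\<^sub>R b)"
        using tc(1) insert(1,2) by simp
      moreover have "\<forall>b\<in>insert d C. \<bar>(c(d := t)) b\<bar> \<le> r" using tc insert(2) by auto
      ultimately show "z \<in> ?K (insert d C)" by blast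
    next
      fix z assume "z \<in> ?K (insert d C)"
      then obtain c where c: "z = (\<Sum>b\<in>insert d C. c b *\<^sub>R b)" "\<forall>b\<in>insert d C. \<bar>c b\<bar> \<le> r" by blast
      then have "z = c d *\<^sub>R d + (\<Sum>b\<in>C. c b *\<^sub>R b)" "c d \<in> {-r..r}"
        using insert(1,2) by auto
      then show "z \<in> {x + y |x y. x \<in> (\<lambda>t. t *\<^sub>R d) ` {-r..r} \<and> y \<in> ?K C}" using c(2) by blast
    qed
    finally show ?case .
  qed
  then have "compact {\<Sum>b\<in>B. c b *\<^sub>R b |c. \<forall>b\<in>B. \<bar>c b\<bar> \<le> r}" (is "compact ?K") using fin by blast
  then have "compact (?K \<inter> cball 0 r)" by (rule compact_Int_closed) simp
  moreover have "cball 0 r \<subseteq> {\<Sum>b\<in>B. c b *\<^sub>R b |c. \<forall>b\<in>B. \<bar>c b\<bar> \<le> r}"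
  proof
    fix x :: 'a assume "x \<in> cball 0 r"
    then have "\<forall>b\<in>B. \<bar>x \<bullet> b\<bar> \<le> r"
      using Cauchy_Schwarz_ineq2[of x] nb by (metis mem_cball_0 mult.right_neutral order_trans)
    then show "x \<in> {\<Sum>b\<in>B. c b *\<^sub>R b |c. \<forall>b\<in>B. \<bar>c b\<bar> \<le> r}"
      using ex[of x] by (intro CollectI exI[of _ "\<lambda>b. x \<bullet> b"]) auto
  qed
  ultimately have "compact (cball 0 r :: 'a set)" by (simp only: Int_absorb1)
  then have "compact ((+) a ` cball 0 r)" by (rule compact_translation)
  then show ?thesis by simp
qed

section \<open>Bump functions\<close>

text \<open>For \<open>n = 0\<close> this is the classical function that is flat at 0; the powers of
  \<open>1 / t\<close> are those produced by differentiating it.\<close>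

definition flat_exp :: "nat \<Rightarrow> real \<Rightarrow> real" where
  "flat_exp n t = (if t > 0 then (1 / t) ^ n * exp (- (1 / t)) else 0)"

text \<open>Replacing \<open>t\<close> by \<open>1 / t\<close> turns the limit from the right into
  the decay of \<open>t ^ n / exp t\<close> at infinity.\<close>

lemma flat_exp_tendsto_0: "(flat_exp n \<longlongrightarrow> 0) (at 0)"
proof -
  have "((\<lambda>t::real. t ^ n / exp t) \<longlongrightarrow> 0) at_top" by (rule tendsto_power_div_exp_0)
  then have "((\<lambda>t::real. inverse t ^ n / exp (inverse t)) \<longlongrightarrow> 0) (at_right 0)"
    by (rule filterlim_compose[OF _ filterlim_inverse_at_top_right])
  then have "(flat_exp n \<longlongrightarrow> 0) (at_right 0)"
    by (rule Lim_transform_eventually)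
       (auto simp: flat_exp_def eventually_at_filter exp_minus divide_simps)
  moreover have "(flat_exp n \<longlongrightarrow> 0) (at_left 0)"
    by (rule Lim_transform_eventually[of "\<lambda>_. 0"]) (auto simp: flat_exp_def eventually_at_filter)
  ultimately show ?thesis using filterlim_split_at by blast
qed

lemma flat_exp_deriv:
  "(flat_exp n has_real_derivative flat_exp (n + 2) t - of_nat n * flat_exp (n + 1) t) (at t)"
proof -
  consider "t > 0" | "t < 0" | "t = 0" by linarith
  then show ?thesis
  proof cases
    case 1
    have "((\<lambda>t. (1 / t) ^ n * exp (- (1 / t))) has_real_derivative
        flat_exp (n + 2) t - of_nat n * flat_exp (n + 1) t) (at t)"
    proof -
      have i: "((\<lambda>t. 1 / t) has_real_derivative - ((1 / t)\<^sup>2)) (at t)"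
        using 1 by (auto intro!: derivative_eq_intros simp: power2_eq_square)
      have h1: "((\<lambda>t. (1 / t) ^ n) has_real_derivative - (of_nat n * (1 / t) ^ (n + 1))) (at t)"
        using DERIV_power[OF i, of n] by (cases n) (simp_all add: power2_eq_square mult_ac)
      have h2: "((\<lambda>t. exp (- (1 / t))) has_real_derivative exp (- (1 / t)) * (1 / t)\<^sup>2) (at t)"
        using DERIV_chain2[OF DERIV_exp DERIV_minus[OF i]] by simp
      show ?thesis
        by (rule DERIV_cong[OF DERIV_mult[OF h1 h2]])
           (use 1 in \<open>simp add: flat_exp_def power2_eq_square algebra_simps\<close>)
    qed
    then show ?thesis
      by (rule has_field_derivative_transform_within_open[of _ _ _ "{0<..}"])
         (use 1 in \<open>auto simp: flat_exp_def\<close>)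
  next
    case 2
    have "((\<lambda>t. 0) has_real_derivative flat_exp (n + 2) t - of_nat n * flat_exp (n + 1) t) (at t)"
      using 2 by (simp add: flat_exp_def)
    then show ?thesis
      by (rule has_field_derivative_transform_within_open[of _ _ _ "{..<0}"])
         (use 2 in \<open>auto simp: flat_exp_def\<close>)
  next
    case 3
    \<comment> \<open>Away from 0 this difference quotient is \<open>flat_exp (Suc n)\<close>, whose
      limit at 0 is known.\<close>
    have "((\<lambda>h. (flat_exp n (0 + h) - flat_exp n 0) / h) \<longlongrightarrow> 0) (at 0)"
      by (rule Lim_transform_eventually[OF flat_exp_tendsto_0[of "Suc n"]])
         (auto simp: flat_exp_def eventually_at_filter field_simps)
    then show ?thesis using 3 by (simp add: DERIV_def flat_exp_def)
  qed
qed

text \<open>The derivative of a member of the family \<open>flat_exp n\<close> is a combination of members, so that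
  the induction on the order of differentiability runs over all \<open>n\<close> at once.\<close>

lemma Ck_on_flat_exp:
  fixes q :: "'a::real_normed_vector \<Rightarrow> real"
  assumes "open S" "smooth_on S q"
  shows "Ck_on k S (\<lambda>x. flat_exp n (q x))"
proof (induction k arbitrary: n)
  case 0
  have "continuous_on S q" using assms(2) Ck_on.simps(1) unfolding smooth_on_def by blast
  moreover have "continuous_on UNIV (flat_exp n)"
    using flat_exp_deriv DERIV_isCont by (metis continuous_at_imp_continuous_on)
  ultimately show ?case
    using continuous_on_compose2[of UNIV "flat_exp n" S q] by auto
next
  case (Suc k)
  have q: "Ck_on k S q" "Ck_on (Suc k) S q" for k using assms(2) unfolding smooth_on_def by blast+
  define r where "r x = flat_exp (n + 2) (q x) - of_nat n * flat_exp (n + 1) (q x)" for x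
  have d: "((\<lambda>x. flat_exp n (q x)) has_derivative
      (\<lambda>v. r x * frechet_derivative q (at x) v)) (at x)" if "x \<in> S" for x
  proof -
    have "(q has_derivative frechet_derivative q (at x)) (at x)"
      using q(2)[of 0] that by (auto simp: frechet_derivative_works[symmetric])
    then show ?thesis unfolding r_def
      using has_derivative_compose flat_exp_deriv[of n "q x"] unfolding has_field_derivative_def
      by blast
  qed
  have "Ck_on k S (\<lambda>x. flat_exp (n + 2) (q x) + (- of_nat n) * flat_exp (n + 1) (q x))"
    by (intro Ck_on_add bounded_bilinear.Ck_on_bilinear[OF bounded_bilinear_mult] Ck_on_const Suc.IH assms)
  then have r: "Ck_on k S r" by (rule Ck_on_cong[OF assms(1), rotated]) (simp add: r_def)
  have "Ck_on k S (\<lambda>x. frechet_derivative (\<lambda>x. flat_exp n (q x)) (at x) v)" for v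
  proof (rule Ck_on_cong[OF assms(1)])
    show "Ck_on k S (\<lambda>x. r x * frechet_derivative q (at x) v)"
      using q(2)[of k] by (intro bounded_bilinear.Ck_on_bilinear[OF bounded_bilinear_mult] r assms) auto
    show "r x * frechet_derivative q (at x) v = frechet_derivative (\<lambda>x. flat_exp n (q x)) (at x) v"
      if "x \<in> S" for x
      using frechet_derivative_at[OF d[OF that]] by metis
  qed
  then show ?case using d by (auto simp: differentiable_def)
qed

lemma smooth_map_on_flat_exp:
  assumes "smooth_manifold M" "open W" "smooth_map_on M W q"
  shows "smooth_map_on M W (\<lambda>x. flat_exp n (q x))"
  using assms(3) unfolding smooth_map_on_def comp_def smooth_on_def[of _ "\<lambda>x. flat_exp _ (_ x)"]
  by (auto intro!: Ck_on_flat_exp open_chart_image[OF assms(1) _ assms(2)])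

text \<open>A radial \<open>flat_exp\<close> profile in one chart, extended by zero. The closed set
  \<open>K\<close> inside \<open>W\<close> lets local objects on \<open>W\<close> be multiplied by
  \<open>h\<close> and extended by zero to the whole manifold.\<close>

lemma smooth_cutoff:
  fixes M :: "('m::{t2_space,second_countable_topology}, 'e::real_inner, 'z) manifold_data_scheme"
  assumes M: "smooth_manifold M" and W: "open W" "x \<in> W"
  obtains h K where "smooth_map_on M UNIV h" "h x = (1::real)" "closed K" "K \<subseteq> W"
    "\<And>y. y \<notin> K \<Longrightarrow> h y = 0"
proof -
  have "(\<Union>(U, \<phi>)\<in>atlas M. U) = UNIV" using M unfolding smooth_manifold_def by (elim conjE)
  then have "x \<in> (\<Union>(U, \<phi>)\<in>atlas M. U)" by simp
  then obtain U \<phi> where c: "(U, \<phi>) \<in> atlas M" "x \<in> U" by auto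
  have U: "open U" and hom: "homeomorphism U (\<phi> ` U) \<phi> (inv_into U \<phi>)" and fd: "finite_dim TYPE('e)"
    using M c(1) unfolding smooth_manifold_def by fast+
  define a where "a = \<phi> x"
  have "a \<in> \<phi> ` (U \<inter> W)" using c W a_def by blast
  then obtain r where r: "r > 0" "cball a r \<subseteq> \<phi> ` (U \<inter> W)"
    using open_chart_image[OF M c(1) W(1)] open_contains_cball by blast
  \<comment> \<open>A compact set in a Hausdorff space is closed, so the complement of
    \<open>K\<close> is open and serves as the second piece of a cover.\<close>
  define K where "K = inv_into U \<phi> ` cball a r"
  have "continuous_on (cball a r) (inv_into U \<phi>)"
    using hom r(2) by (auto simp: homeomorphism_def intro: continuous_on_subset)
  then have "closed K"
    unfolding K_def
    using compact_cball_finite_dim[OF fd] by (intro compact_imp_closed compact_continuous_image)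
  have "K \<subseteq> U \<inter> W"
    unfolding K_def using r(2) chart_inverse[OF M c(1)] by fastforce
  \<comment> \<open>The value of the unnormalised bump at \<open>x\<close>, where \<open>q\<close>
    equals the square of \<open>r\<close>.\<close>
  define k where "k = flat_exp 0 (r\<^sup>2)"
  have "k \<noteq> 0" using r(1) by (simp add: k_def flat_exp_def)
  \<comment> \<open>Positive on \<open>U\<close> exactly where \<open>\<phi> y\<close> lies in the
    open ball; it is written with sums and products only, to match the closure rules for smooth
    maps.\<close>
  define q where "q y = r\<^sup>2 + (- 1) * ((\<phi> y + (- a)) \<bullet> (\<phi> y + (- a)))" for y
  define h where "h y = (if y \<in> U then (1 / k) * flat_exp 0 (q y) else 0)" for y
  have 0: "h y = 0" if "y \<notin> K" for y
  proof (cases "y \<in> U")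
    case True
    have "\<phi> y \<notin> cball a r"
      using that chart_inverse[OF M c(1) True] unfolding K_def by (metis image_eqI)
    then have "norm (\<phi> y + (- a)) > r" by (simp add: dist_norm norm_minus_commute)
    then have "(norm (\<phi> y + (- a)))\<^sup>2 > r\<^sup>2" using r(1) by (intro power_strict_mono) auto
    then have "q y \<le> 0" unfolding q_def power2_norm_eq_inner by linarith
    then show ?thesis by (simp add: h_def flat_exp_def)
  qed (simp add: h_def)
  \<comment> \<open>Read in the other charts, a chart becomes a transition map of the atlas.\<close>
  have \<phi>: "smooth_map_on M U \<phi>"
    using M c(1) unfolding smooth_map_on_def smooth_manifold_def by (auto simp: Int_commute)
  have "smooth_map_on M U q"
    unfolding q_def
    by (intro smooth_map_on_add[OF M U] smooth_map_on_mult[OF M U] smooth_map_on_inner[OF M U]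
        smooth_map_on_const \<phi>)
  then have "smooth_map_on M U (\<lambda>y. (1 / k) * flat_exp 0 (q y))"
    by (intro smooth_map_on_mult[OF M U] smooth_map_on_const smooth_map_on_flat_exp[OF M U])
  then have "smooth_map_on M U h"
    by (rule smooth_map_on_cong[OF M U, rotated]) (simp add: h_def)
  moreover have "smooth_map_on M (- K) h"
    by (rule smooth_map_on_cong[OF M _ _ smooth_map_on_const[where c = 0]])
       (use 0 \<open>closed K\<close> in auto)
  ultimately have "smooth_map_on M (\<Union>V\<in>{U, - K}. V) h"
    using U \<open>closed K\<close> by (intro smooth_map_on_UN[OF M]) auto
  moreover have "(\<Union>V\<in>{U, - K}. V) = UNIV" using \<open>K \<subseteq> U \<inter> W\<close> by auto
  ultimately have "smooth_map_on M UNIV h" by simp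
  moreover have "h x = 1" using c(2) \<open>k \<noteq> 0\<close> by (simp add: h_def q_def a_def k_def)
  ultimately show ?thesis using that \<open>closed K\<close> \<open>K \<subseteq> U \<inter> W\<close> 0 by blast
qed

section \<open>Vector bundles\<close>

lemma linear_on_sum:
  assumes "subspace S" "linear_on S f" "\<And>i. i \<in> I \<Longrightarrow> v i \<in> S"
  shows "f (\<Sum>i\<in>I. c i *\<^sub>R v i) = (\<Sum>i\<in>I. c i *\<^sub>R f (v i))"
  using assms(3)
proof (induction I rule: infinite_finite_induct)
  case (infinite A)
  have "f (0 *\<^sub>R 0) = 0 *\<^sub>R f 0" using assms(1,2) subspace_0 unfolding linear_on_def by blast
  then show ?case using infinite by simp
next
  case empty
  have "f (0 *\<^sub>R 0) = 0 *\<^sub>R f 0" using assms(1,2) subspace_0 unfolding linear_on_def by blast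
  then show ?case by simp
next
  case (insert x F)
  have "(\<Sum>i\<in>F. c i *\<^sub>R v i) \<in> S"
    using assms(1) insert.prems by (intro subspace_sum subspace_scale) auto
  moreover have "c x *\<^sub>R v x \<in> S" "v x \<in> S" using assms(1) insert.prems by (auto intro: subspace_scale)
  ultimately show ?case using insert assms(2) by (simp add: linear_on_def)
qed

lemma linear_on_diff:
  assumes "subspace S" "linear_on S f" "u \<in> S" "v \<in> S"
  shows "f (u - v) = f u - f v"
proof -
  have "f ((u - v) + v) = f (u - v) + f v"
    using assms subspace_diff unfolding linear_on_def by blast
  then show ?thesis by simp
qed

context
  fixes E :: "('m::{t2_space,second_countable_topology}, 'e::real_inner, 'v::real_vector,
    'f::real_inner, 'z) vector_bundle_data_scheme"
  assumes vb: "vector_bundle E"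
begin

lemma bundle_manifold: "smooth_manifold E"
  using vb unfolding vector_bundle_def by (elim conjE)

lemma subspace_fibre: "subspace (fibre E x)"
  using vb unfolding vector_bundle_def by (elim conjE) (erule spec)

lemma fibre_closed:
  "0 \<in> fibre E x"
  "v \<in> fibre E x \<Longrightarrow> w \<in> fibre E x \<Longrightarrow> v + w \<in> fibre E x"
  "v \<in> fibre E x \<Longrightarrow> w \<in> fibre E x \<Longrightarrow> v - w \<in> fibre E x"
  "v \<in> fibre E x \<Longrightarrow> c *\<^sub>R v \<in> fibre E x"
  "v \<in> fibre E x \<Longrightarrow> - v \<in> fibre E x"
  using subspace_fibre[of x]
  by (auto intro: subspace_0 subspace_add subspace_diff subspace_scale subspace_neg)

lemma exists_triv: obtains U \<Phi> where "(U, \<Phi>) \<in> trivs E" "x \<in> U"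
proof -
  have "(\<Union>(U, \<Phi>)\<in>trivs E. U) = UNIV" using vb unfolding vector_bundle_def by (elim conjE)
  then have "x \<in> (\<Union>(U, \<Phi>)\<in>trivs E. U)" by simp
  then show ?thesis using that by auto
qed

lemma triv_open: "(U, \<Phi>) \<in> trivs E \<Longrightarrow> open U"
  using vb unfolding vector_bundle_def by fast

lemma exists_model_basis: obtains B :: "'f set" where "orthonormal_basis B"
proof -
  have "finite_dim TYPE('f)" using vb unfolding vector_bundle_def by (elim conjE)
  then show ?thesis using that exists_orthonormal_basis by blast
qed

lemma triv_linear: "(U, \<Phi>) \<in> trivs E \<Longrightarrow> x \<in> U \<Longrightarrow> linear_on (fibre E x) (\<Phi> x)"
  using vb unfolding vector_bundle_def by fast

lemma triv_bij: "(U, \<Phi>) \<in> trivs E \<Longrightarrow> x \<in> U \<Longrightarrow> bij_betw (\<Phi> x) (fibre E x) UNIV"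
  using vb unfolding vector_bundle_def by fast

lemma triv_frame_smooth:
  assumes "(U, \<Phi>) \<in> trivs E" "(V, \<Psi>) \<in> trivs E"
  shows "smooth_map_on E (U \<inter> V) (\<lambda>x. \<Psi> x (frame E \<Phi> u x))"
  using vb assms unfolding vector_bundle_def by fast

lemma frame_in_fibre: "(U, \<Phi>) \<in> trivs E \<Longrightarrow> x \<in> U \<Longrightarrow> frame E \<Phi> u x \<in> fibre E x"
  using triv_bij[of U \<Phi> x] unfolding frame_def bij_betw_def by (metis UNIV_I inv_into_into)

lemma triv_frame: "(U, \<Phi>) \<in> trivs E \<Longrightarrow> x \<in> U \<Longrightarrow> \<Phi> x (frame E \<Phi> u x) = u"
  using triv_bij[of U \<Phi> x] unfolding frame_def bij_betw_def by (metis UNIV_I f_inv_into_f)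

lemma frame_triv: "(U, \<Phi>) \<in> trivs E \<Longrightarrow> x \<in> U \<Longrightarrow> v \<in> fibre E x \<Longrightarrow> frame E \<Phi> (\<Phi> x v) x = v"
  using triv_bij[of U \<Phi> x] unfolding frame_def bij_betw_def by (simp add: inv_into_f_f)

text \<open>The trivialisation is injective on the fibre, so \<open>v\<close> equals the combination
  of frame vectors with the same coordinates. This reduces smoothness of a tensor field on sections
  to smoothness of its components.\<close>

lemma frame_expansion:
  assumes t: "(U, \<Phi>) \<in> trivs E" "x \<in> U" and B: "orthonormal_basis B"
    and v: "v \<in> fibre E x" and L: "linear_on (fibre E x) L"
  shows "L v = (\<Sum>b\<in>B. (\<Phi> x v \<bullet> b) *\<^sub>R L (frame E \<Phi> b x))"
proof -
  let ?w = "\<Sum>b\<in>B. (\<Phi> x v \<bullet> b) *\<^sub>R frame E \<Phi> b x"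
  note f = frame_in_fibre[OF t]
  have "?w \<in> fibre E x" using subspace_fibre f by (intro subspace_sum subspace_scale)
  moreover have "\<Phi> x ?w = \<Phi> x v"
    using linear_on_sum[OF subspace_fibre triv_linear[OF t] f, where I = B] triv_frame[OF t] B
    by (simp add: orthonormal_basis_def)
  ultimately have "v = ?w"
    using inj_onD[OF bij_betw_imp_inj_on[OF triv_bij[OF t]], of v ?w] v by simp
  then have "L v = L ?w" by simp
  also have "\<dots> = (\<Sum>b\<in>B. (\<Phi> x v \<bullet> b) *\<^sub>R L (frame E \<Phi> b x))"
    by (rule linear_on_sum[OF subspace_fibre L f])
  finally show ?thesis .
qed

lemma section_in_fibre: "X \<in> sections E \<Longrightarrow> X x \<in> fibre E x"
  unfolding sections_def by blast

lemma section_smooth: "X \<in> sections E \<Longrightarrow> (U, \<Phi>) \<in> trivs E \<Longrightarrow> smooth_map_on E U (\<lambda>x. \<Phi> x (X x))"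
  unfolding sections_def by fast

text \<open>A local section constant in a trivialisation, times a cutoff. It allows conditions
  imposed on sections to be used at an arbitrary vector of a fibre.\<close>

lemma section_through:
  assumes w: "w \<in> fibre E x"
  obtains Z where "Z \<in> sections E" "Z x = w"
proof -
  obtain U \<Phi> where t: "(U, \<Phi>) \<in> trivs E" "x \<in> U" using exists_triv .
  obtain h K where h: "smooth_map_on E UNIV h" "h x = (1::real)" "closed K" "K \<subseteq> U"
    "\<And>y. y \<notin> K \<Longrightarrow> h y = 0"
    using smooth_cutoff[OF bundle_manifold triv_open[OF t(1)] t(2)] by metis
  define Z where "Z y = (if y \<in> U then h y *\<^sub>R frame E \<Phi> (\<Phi> x w) y else 0)" for y
  have "Z x = w" using t h(2) w by (simp add: Z_def frame_triv)
  moreover have "Z \<in> sections E"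
    unfolding sections_def
  proof (clarify, intro conjI allI ballI, goal_cases)
    case (1 y)
    show ?case using frame_in_fibre[OF t(1)] by (auto simp: Z_def intro: fibre_closed)
  next
    case (2 p)
    obtain V \<Psi> where p: "p = (V, \<Psi>)" and s: "(V, \<Psi>) \<in> trivs E" using 2 by (cases p) auto
    have oV: "open V" and oU: "open U" using triv_open s t by blast+
    have l: "\<Psi> y (c *\<^sub>R v) = c *\<^sub>R \<Psi> y v" if "y \<in> V" "v \<in> fibre E y" for y c v
      using triv_linear[OF s that(1)] that(2) unfolding linear_on_def by blast
    have z: "\<Psi> y (Z y) = 0" if "y \<in> V" "y \<notin> K" for y
      using l[OF that(1) fibre_closed(1), of 0] h(5)[OF that(2)] by (simp add: Z_def)
    \<comment> \<open>Any other trivialisation domain \<open>V\<close> is covered by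
      \<open>U \<inter> V\<close>, where the bundle transition maps are smooth, and
      \<open>V - K\<close>, where \<open>Z\<close> vanishes.\<close>
    have "smooth_map_on E (U \<inter> V) (\<lambda>y. h y *\<^sub>R \<Psi> y (frame E \<Phi> (\<Phi> x w) y))"
      using triv_frame_smooth[OF t(1) s] smooth_map_on_subset[OF h(1)] oU oV
      by (intro smooth_map_on_scaleR[OF bundle_manifold]) auto
    then have "smooth_map_on E (U \<inter> V) (\<lambda>y. \<Psi> y (Z y))"
      by (rule smooth_map_on_cong[OF bundle_manifold, rotated 2])
         (use oU oV in \<open>auto simp: Z_def l frame_in_fibre[OF t(1)]\<close>)
    moreover have "smooth_map_on E (V - K) (\<lambda>y. \<Psi> y (Z y))"
      by (rule smooth_map_on_cong[OF bundle_manifold _ _ smooth_map_on_const[where c = 0]])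
         (use z oV h(3) in auto)
    ultimately have "smooth_map_on E (\<Union>T\<in>{U \<inter> V, V - K}. T) (\<lambda>y. \<Psi> y (Z y))"
      using oU oV h(3) by (intro smooth_map_on_UN[OF bundle_manifold]) auto
    moreover have "(\<Union>T\<in>{U \<inter> V, V - K}. T) = V" using h(4) by auto
    ultimately show ?case by (simp add: p)
  qed
  ultimately show ?thesis using that by blast
qed

text \<open>\<open>two_form\<close> demands linearity in the first slot; skew-symmetry transfers it
  to the second.\<close>

lemma linear_on_two_form:
  assumes "two_form E \<omega>" "v \<in> fibre E x"
  shows "linear_on (fibre E x) (\<lambda>u. \<omega> x u v)" "linear_on (fibre E x) (\<omega> x v)"
proof -
  have *: "linear_on (fibre E x) (\<lambda>u. \<omega> x u v)" if "v \<in> fibre E x" for v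
    using assms(1) that unfolding two_form_def by blast
  show "linear_on (fibre E x) (\<lambda>u. \<omega> x u v)" by (rule *[OF assms(2)])
  have "\<omega> x v u = - \<omega> x u v" if "u \<in> fibre E x" for u
    using assms that unfolding two_form_def by blast
  then show "linear_on (fibre E x) (\<omega> x v)"
    using *[OF assms(2)] fibre_closed unfolding linear_on_def by simp
qed

lemma two_form_skew:
  "two_form E \<omega> \<Longrightarrow> v \<in> fibre E x \<Longrightarrow> w \<in> fibre E x \<Longrightarrow> \<omega> x v w = - \<omega> x w v"
  unfolding two_form_def by blast

lemma smooth_map_on_two_form:
  assumes \<omega>: "two_form E \<omega>" and t: "(U, \<Phi>) \<in> trivs E"
    and X: "\<And>x. x \<in> U \<Longrightarrow> X x \<in> fibre E x" "smooth_map_on E U (\<lambda>x. \<Phi> x (X x))"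
    and Y: "\<And>x. x \<in> U \<Longrightarrow> Y x \<in> fibre E x" "smooth_map_on E U (\<lambda>x. \<Phi> x (Y x))"
  shows "smooth_map_on E U (\<lambda>x. \<omega> x (X x) (Y x))"
proof -
  obtain B :: "'f set" where B: "orthonormal_basis B" using exists_model_basis .
  note M = bundle_manifold triv_open[OF t]
  have e: "\<omega> x (X x) (Y x) = (\<Sum>b\<in>B. (\<Phi> x (X x) \<bullet> b) *
      (\<Sum>c\<in>B. (\<Phi> x (Y x) \<bullet> c) * \<omega> x (frame E \<Phi> b x) (frame E \<Phi> c x)))" if x: "x \<in> U" for x
    using frame_expansion[OF t x B X(1)[OF x] linear_on_two_form(1)[OF \<omega> Y(1)[OF x]]]
      frame_expansion[OF t x B Y(1)[OF x] linear_on_two_form(2)[OF \<omega> frame_in_fibre[OF t x]]]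
    by simp
  have "smooth_map_on E U (\<lambda>x. \<omega> x (frame E \<Phi> b x) (frame E \<Phi> c x))" for b c
    using \<omega> t unfolding two_form_def by fast
  then have s: "smooth_map_on E U (\<lambda>x. \<Sum>b\<in>B. (\<Phi> x (X x) \<bullet> b) *
      (\<Sum>c\<in>B. (\<Phi> x (Y x) \<bullet> c) * \<omega> x (frame E \<Phi> b x) (frame E \<Phi> c x)))"
    by (intro smooth_map_on_sum[OF M] smooth_map_on_mult[OF M] smooth_map_on_inner[OF M]
        smooth_map_on_const X(2) Y(2))
  show ?thesis by (rule smooth_map_on_cong[OF M _ s]) (rule e[symmetric])
qed

text \<open>The anchor obeys its algebraic rules on smooth functions only, so this is needed before
  scalars can be pulled out of the Koszul formula.\<close>

lemma two_form_smooth_function: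
  assumes "two_form E \<omega>" "X \<in> sections E" "Y \<in> sections E"
  shows "(\<lambda>x. \<omega> x (X x) (Y x)) \<in> smooth_functions E"
proof -
  have "smooth_map_on E (\<Union>p\<in>trivs E. fst p) (\<lambda>x. \<omega> x (X x) (Y x))"
  proof (rule smooth_map_on_UN[OF bundle_manifold])
    fix p assume "p \<in> trivs E"
    then have p: "(fst p, snd p) \<in> trivs E" by simp
    show "open (fst p)" by (rule triv_open[OF p])
    show "smooth_map_on E (fst p) (\<lambda>x. \<omega> x (X x) (Y x))"
      by (rule smooth_map_on_two_form[OF assms(1) p section_in_fibre[OF assms(2)]
          section_smooth[OF assms(2) p] section_in_fibre[OF assms(3)] section_smooth[OF assms(3) p]])
  qed
  moreover have "(\<Union>p\<in>trivs E. fst p) = UNIV"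
  proof -
    have "x \<in> (\<Union>p\<in>trivs E. fst p)" for x by (rule exists_triv[of x]) (metis UN_I fst_conv)
    then show ?thesis by blast
  qed
  ultimately show ?thesis by (simp add: smooth_functions_def)
qed

lemma smooth_map_on_endo:
  assumes N: "bundle_endo E N" and t: "(U, \<Phi>) \<in> trivs E"
    and X: "\<And>x. x \<in> U \<Longrightarrow> X x \<in> fibre E x" "smooth_map_on E U (\<lambda>x. \<Phi> x (X x))"
  shows "smooth_map_on E U (\<lambda>x. \<Phi> x (N x (X x)))"
proof -
  obtain B :: "'f set" where B: "orthonormal_basis B" using exists_model_basis .
  note M = bundle_manifold triv_open[OF t]
  have e: "\<Phi> x (N x (X x)) = (\<Sum>b\<in>B. (\<Phi> x (X x) \<bullet> b) *\<^sub>R \<Phi> x (N x (frame E \<Phi> b x)))"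
    if x: "x \<in> U" for x
  proof (rule frame_expansion[OF t x B X(1)[OF x]])
    have "linear_on (fibre E x) (N x)" "\<forall>v\<in>fibre E x. N x v \<in> fibre E x"
      using N unfolding bundle_endo_def by blast+
    then show "linear_on (fibre E x) (\<lambda>v. \<Phi> x (N x v))"
      using triv_linear[OF t x] fibre_closed unfolding linear_on_def by simp
  qed
  have "smooth_map_on E U (\<lambda>x. \<Phi> x (N x (frame E \<Phi> b x)))" for b
    using N t unfolding bundle_endo_def by fast
  then have s: "smooth_map_on E U
      (\<lambda>x. \<Sum>b\<in>B. (\<Phi> x (X x) \<bullet> b) *\<^sub>R \<Phi> x (N x (frame E \<Phi> b x)))"
    by (intro smooth_map_on_sum[OF M] smooth_map_on_scaleR[OF M] smooth_map_on_inner[OF M]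
        smooth_map_on_const X(2))
  show ?thesis by (rule smooth_map_on_cong[OF M _ s]) (rule e[symmetric])
qed

text \<open>Makes \<open>N\<close> applied to a section a legitimate argument of brackets and of the
  differential.\<close>

lemma endo_section:
  assumes "bundle_endo E N" "X \<in> sections E"
  shows "(\<lambda>x. N x (X x)) \<in> sections E"
  using assms section_in_fibre[OF assms(2)] smooth_map_on_endo[OF assms(1)] section_smooth[OF assms(2)]
  unfolding sections_def[of E] bundle_endo_def by auto

end

section \<open>Dual fibres, bivectors and the sharp map\<close>

context
  fixes E :: "('m::{t2_space,second_countable_topology}, 'e::real_inner, 'v::real_vector,
    'f::real_inner, 'z) vector_bundle_data_scheme"
  assumes vb: "vector_bundle E"
begin

lemma coframe_dual:
  assumes t: "(U, \<Phi>) \<in> trivs E" "x \<in> U" and "linear \<xi>"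
  shows "coframe E \<Phi> \<xi> x \<in> dual_fibre E x"
  using triv_linear[OF vb t] fibre_closed[OF vb] linear_add[OF \<open>linear \<xi>\<close>] linear_scale[OF \<open>linear \<xi>\<close>]
  unfolding dual_fibre_def coframe_def linear_on_def by simp

lemma coframe_apply: "v \<in> fibre E x \<Longrightarrow> coframe E \<Phi> \<xi> x v = \<xi> (\<Phi> x v)"
  by (simp add: coframe_def)

lemma dual_linear: "\<alpha> \<in> dual_fibre E x \<Longrightarrow> linear_on (fibre E x) \<alpha>"
  unfolding dual_fibre_def by blast

lemma dual_zero: "(\<lambda>v. 0) \<in> dual_fibre E x"
  unfolding dual_fibre_def linear_on_def by simp

lemma dual_add: "\<alpha> \<in> dual_fibre E x \<Longrightarrow> \<beta> \<in> dual_fibre E x \<Longrightarrow> (\<lambda>v. \<alpha> v + \<beta> v) \<in> dual_fibre E x"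
  unfolding dual_fibre_def linear_on_def by (simp add: algebra_simps)

lemma dual_scale: "\<alpha> \<in> dual_fibre E x \<Longrightarrow> (\<lambda>v. c * \<alpha> v) \<in> dual_fibre E x"
  unfolding dual_fibre_def linear_on_def by (simp add: algebra_simps)

lemma dual_sum:
  "(\<And>i. i \<in> I \<Longrightarrow> \<alpha> i \<in> dual_fibre E x) \<Longrightarrow> (\<lambda>v. \<Sum>i\<in>I. c i * \<alpha> i v) \<in> dual_fibre E x"
proof (induction I rule: infinite_finite_induct)
  case (insert i I)
  then have "(\<lambda>v. c i * \<alpha> i v + (\<Sum>j\<in>I. c j * \<alpha> j v)) \<in> dual_fibre E x"
    by (intro dual_add dual_scale) auto
  then show ?case using insert by simp
qed (auto simp: dual_zero)

lemma bivector_add: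
  "bivector E \<pi> \<Longrightarrow> \<alpha> \<in> dual_fibre E x \<Longrightarrow> \<beta> \<in> dual_fibre E x \<Longrightarrow> \<gamma> \<in> dual_fibre E x \<Longrightarrow>
    \<pi> x (\<lambda>v. \<alpha> v + \<gamma> v) \<beta> = \<pi> x \<alpha> \<beta> + \<pi> x \<gamma> \<beta>"
  unfolding bivector_def by blast

lemma bivector_scale:
  "bivector E \<pi> \<Longrightarrow> \<alpha> \<in> dual_fibre E x \<Longrightarrow> \<beta> \<in> dual_fibre E x \<Longrightarrow>
    \<pi> x (\<lambda>v. c * \<alpha> v) \<beta> = c * \<pi> x \<alpha> \<beta>"
  unfolding bivector_def by blast

lemma bivector_skew:
  "bivector E \<pi> \<Longrightarrow> \<alpha> \<in> dual_fibre E x \<Longrightarrow> \<beta> \<in> dual_fibre E x \<Longrightarrow> \<pi> x \<alpha> \<beta> = - \<pi> x \<beta> \<alpha>"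
  unfolding bivector_def by blast

lemma bivector_sum:
  assumes "bivector E \<pi>" "\<beta> \<in> dual_fibre E x" "\<And>i. i \<in> I \<Longrightarrow> \<alpha> i \<in> dual_fibre E x"
  shows "\<pi> x (\<lambda>v. \<Sum>i\<in>I. c i * \<alpha> i v) \<beta> = (\<Sum>i\<in>I. c i * \<pi> x (\<alpha> i) \<beta>)"
  using assms(3)
proof (induction I rule: infinite_finite_induct)
  case (insert i I)
  have "\<pi> x (\<lambda>v. c i * \<alpha> i v + (\<Sum>j\<in>I. c j * \<alpha> j v)) \<beta> =
      \<pi> x (\<lambda>v. c i * \<alpha> i v) \<beta> + \<pi> x (\<lambda>v. \<Sum>j\<in>I. c j * \<alpha> j v) \<beta>"
    using insert.prems by (intro bivector_add assms(1,2) dual_scale dual_sum) auto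
  moreover have "\<pi> x (\<lambda>v. c i * \<alpha> i v) \<beta> = c i * \<pi> x (\<alpha> i) \<beta>"
    using insert.prems by (intro bivector_scale assms(1,2)) auto
  ultimately show ?case using insert by simp
qed (use bivector_scale[OF assms(1) dual_zero assms(2), of 0] in simp_all)

lemma bivector_expansion:
  assumes t: "(U, \<Phi>) \<in> trivs E" "x \<in> U" and B: "orthonormal_basis B"
    and \<pi>: "bivector E \<pi>" and \<alpha>: "\<alpha> \<in> dual_fibre E x" and \<beta>: "\<beta> \<in> dual_fibre E x"
  shows "\<pi> x \<alpha> \<beta> = (\<Sum>b\<in>B. \<alpha> (frame E \<Phi> b x) * \<pi> x (coframe E \<Phi> (\<lambda>u. u \<bullet> b) x) \<beta>)"
proof -
  \<comment> \<open>Off the fibre both sides are 0 by the convention for covectors, so the two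
    covectors agree as functions.\<close>
  have "\<alpha> v = (\<Sum>b\<in>B. \<alpha> (frame E \<Phi> b x) * coframe E \<Phi> (\<lambda>u. u \<bullet> b) x v)" for v
  proof (cases "v \<in> fibre E x")
    case True
    then show ?thesis
      using frame_expansion[OF vb t B True dual_linear[OF \<alpha>]] by (simp add: coframe_def mult.commute)
  next
    case False
    then show ?thesis using \<alpha> by (simp add: coframe_def dual_fibre_def)
  qed
  then have "\<alpha> = (\<lambda>v. \<Sum>b\<in>B. \<alpha> (frame E \<Phi> b x) * coframe E \<Phi> (\<lambda>u. u \<bullet> b) x v)" by blast
  then have "\<pi> x \<alpha> \<beta> =
      \<pi> x (\<lambda>v. \<Sum>b\<in>B. \<alpha> (frame E \<Phi> b x) * coframe E \<Phi> (\<lambda>u. u \<bullet> b) x v) \<beta>" by simp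
  also have "\<dots> = (\<Sum>b\<in>B. \<alpha> (frame E \<Phi> b x) * \<pi> x (coframe E \<Phi> (\<lambda>u. u \<bullet> b) x) \<beta>)"
    by (rule bivector_sum[OF \<pi> \<beta>])
       (intro coframe_dual[OF t] bounded_linear.linear bounded_linear_inner_left)
  finally show ?thesis .
qed

text \<open>Reflexivity of the fibre in coordinates: an explicit vector built from a frame meets the
  description in \<open>sharp\<close>, and coframes separate vectors, so it is the only one.\<close>

lemma sharp_apply:
  assumes \<pi>: "bivector E \<pi>" and \<alpha>: "\<alpha> \<in> dual_fibre E x"
  shows "sharp E \<pi> x \<alpha> \<in> fibre E x \<and> (\<forall>\<beta>\<in>dual_fibre E x. \<beta> (sharp E \<pi> x \<alpha>) = \<pi> x \<alpha> \<beta>)"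
proof -
  obtain U \<Phi> where t: "(U, \<Phi>) \<in> trivs E" "x \<in> U" using exists_triv[OF vb] .
  obtain B :: "'f set" where B: "orthonormal_basis B" using exists_model_basis[OF vb] .
  have cd: "coframe E \<Phi> (\<lambda>u. u \<bullet> b) x \<in> dual_fibre E x" for b
    by (intro coframe_dual[OF t] bounded_linear.linear bounded_linear_inner_left)
  define v where "v = (\<Sum>b\<in>B. \<pi> x \<alpha> (coframe E \<Phi> (\<lambda>u. u \<bullet> b) x) *\<^sub>R frame E \<Phi> b x)"
  have v: "v \<in> fibre E x"
    unfolding v_def
    by (rule subspace_sum[OF subspace_fibre[OF vb]]) (rule fibre_closed(4)[OF vb frame_in_fibre[OF vb t]])
  have ev: "\<beta> v = \<pi> x \<alpha> \<beta>" if \<beta>: "\<beta> \<in> dual_fibre E x" for \<beta>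
  proof -
    have "\<beta> v = (\<Sum>b\<in>B. \<pi> x \<alpha> (coframe E \<Phi> (\<lambda>u. u \<bullet> b) x) * \<beta> (frame E \<Phi> b x))"
      unfolding v_def
      using linear_on_sum[OF subspace_fibre[OF vb] dual_linear[OF \<beta>] frame_in_fibre[OF vb t], where I = B]
      by simp
    \<comment> \<open>The available expansion is in the first argument of the bivector, hence the
      detour through skew-symmetry.\<close>
    also have "\<dots> = - \<pi> x \<beta> \<alpha>"
      unfolding bivector_expansion[OF t B \<pi> \<beta> \<alpha>] sum_negf[symmetric]
      by (rule sum.cong) (simp_all add: bivector_skew[OF \<pi> \<alpha> cd])
    also have "\<dots> = \<pi> x \<alpha> \<beta>" by (simp add: bivector_skew[OF \<pi> \<alpha> \<beta>])
    finally show ?thesis .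
  qed
  have uniq: "w = v" if w: "w \<in> fibre E x" "\<forall>\<beta>\<in>dual_fibre E x. \<beta> w = \<pi> x \<alpha> \<beta>" for w
  proof -
    have "\<Phi> x w \<bullet> b = \<Phi> x v \<bullet> b" for b
      using w(2) ev cd[of b] coframe_apply[OF w(1)] coframe_apply[OF v] by metis
    then have "\<Phi> x w = \<Phi> x v" by (metis inner_commute vector_eq_ldot)
    then show ?thesis
      using inj_onD[OF bij_betw_imp_inj_on[OF triv_bij[OF vb t]], of w v] v w(1) by simp
  qed
  show ?thesis
    unfolding sharp_def by (rule theI[of _ v]) (use v ev uniq in blast)+
qed

lemma flat_dual:
  assumes "two_form E \<omega>" "v \<in> fibre E x"
  shows "flat E \<omega> x v \<in> dual_fibre E x"
  using linear_on_two_form(2)[OF vb assms] fibre_closed[OF vb]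
  unfolding dual_fibre_def flat_def linear_on_def by simp

text \<open>Injectivity of the flat map, in the form that serves to prove vector identities by
  pairing with a symplectic form.\<close>

lemma nondegenerate_ext:
  assumes "two_form E \<omega>" "nondegenerate E \<omega>" and v: "v \<in> fibre E x" and w: "w \<in> fibre E x"
    and eq: "\<And>u. u \<in> fibre E x \<Longrightarrow> \<omega> x v u = \<omega> x w u"
  shows "v = w"
proof -
  have "\<omega> x (v - w) u = 0" if "u \<in> fibre E x" for u
    using linear_on_diff[OF subspace_fibre[OF vb] linear_on_two_form(1)[OF vb assms(1) that] v w] eq[OF that]
    by simp
  moreover have "v - w \<in> fibre E x" by (rule fibre_closed(3)[OF vb v w])
  ultimately have "v - w = 0" using assms(2) unfolding nondegenerate_def by blast
  then show ?thesis by simp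
qed

end

lemma lie_algebroid_bundle: "lie_algebroid A \<Longrightarrow> vector_bundle A"
  unfolding lie_algebroid_def by blast

section \<open>The tensor \<open>sharp \<pi>\<close> after \<open>flat \<omega>'\<close> as a bundle
  endomorphism\<close>

context
  fixes A :: "('m::{t2_space,second_countable_topology}, 'e::real_inner, 'v::real_vector,
      'f::real_inner, 'z) lie_algebroid_data_scheme"
    and \<omega> \<omega>' :: "'m \<Rightarrow> 'v \<Rightarrow> 'v \<Rightarrow> real"
    and \<pi> :: "'m \<Rightarrow> ('v \<Rightarrow> real) \<Rightarrow> ('v \<Rightarrow> real) \<Rightarrow> real"
  assumes A: "lie_algebroid A" and \<omega>: "symplectic A \<omega>" and \<omega>': "symplectic A \<omega>'"
    and \<pi>: "inverse_bivector A \<omega> \<pi>"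
begin

lemma sharp_flat_in_fibre:
  assumes "v \<in> fibre A x"
  shows "sharp A \<pi> x (flat A \<omega>' x v) \<in> fibre A x"
  using sharp_apply[OF lie_algebroid_bundle[OF A]] flat_dual[OF lie_algebroid_bundle[OF A] _ assms] \<pi> \<omega>'
  unfolding inverse_bivector_def symplectic_def closed_two_form_def by blast

text \<open>This is flat after sharp being the identity, evaluated at \<open>w\<close>. Algebraic
  identities between transition tensors are derived from this relation.\<close>

lemma sharp_flat_eq:
  assumes "v \<in> fibre A x" "w \<in> fibre A x"
  shows "\<omega> x (sharp A \<pi> x (flat A \<omega>' x v)) w = \<omega>' x v w"
proof -
  have "flat A \<omega>' x v \<in> dual_fibre A x"
    using flat_dual[OF lie_algebroid_bundle[OF A] _ assms(1)] \<omega>'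
    unfolding symplectic_def closed_two_form_def by blast
  then have "flat A \<omega> x (sharp A \<pi> x (flat A \<omega>' x v)) = flat A \<omega>' x v"
    using \<pi> unfolding inverse_bivector_def by blast
  from fun_cong[OF this, of w] show ?thesis using assms(2) by (simp add: flat_def)
qed

text \<open>Linearity follows by pairing with \<open>\<omega>\<close>. In a frame, the matrix is the
  product of the component matrices of \<open>\<omega>'\<close> and \<open>\<pi>\<close>, both
  smooth by hypothesis.\<close>

lemma sharp_flat_endo: "bundle_endo A (\<lambda>x v. sharp A \<pi> x (flat A \<omega>' x v))"
proof -
  note vb = lie_algebroid_bundle[OF A]
  let ?N = "\<lambda>x v. sharp A \<pi> x (flat A \<omega>' x v)"
  have tf: "two_form A \<omega>" "two_form A \<omega>'" and bv: "bivector A \<pi>"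
    using \<omega> \<omega>' \<pi> unfolding symplectic_def closed_two_form_def inverse_bivector_def by blast+
  have "nondegenerate A \<omega>" using \<omega> unfolding symplectic_def by blast
  note ext = nondegenerate_ext[OF vb tf(1) this]
  note eq = sharp_flat_eq and mem = sharp_flat_in_fibre
  have lin: "linear_on (fibre A x) (?N x)" for x
    unfolding linear_on_def
  proof (intro conjI allI ballI)
    fix u v assume uv: "u \<in> fibre A x" "v \<in> fibre A x"
    have "\<omega> x (?N x (u + v)) w = \<omega> x (?N x u + ?N x v) w" if w: "w \<in> fibre A x" for w
      using linear_on_two_form(1)[OF vb tf(1) w] linear_on_two_form(1)[OF vb tf(2) w] uv mem
        fibre_closed[OF vb]
      by (simp add: linear_on_def eq w)
    then show "?N x (u + v) = ?N x u + ?N x v"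
      using uv mem fibre_closed[OF vb] by (intro ext) auto
  next
    fix c u assume u: "u \<in> fibre A x"
    have "\<omega> x (?N x (c *\<^sub>R u)) w = \<omega> x (c *\<^sub>R ?N x u) w" if w: "w \<in> fibre A x" for w
      using linear_on_two_form(1)[OF vb tf(1) w] linear_on_two_form(1)[OF vb tf(2) w] u mem
        fibre_closed[OF vb]
      by (simp add: linear_on_def eq w)
    then show "?N x (c *\<^sub>R u) = c *\<^sub>R ?N x u"
      using u mem fibre_closed[OF vb] by (intro ext) auto
  qed
  have "smooth_map_on A U (\<lambda>x. \<Phi> x (?N x (frame A \<Phi> u x)))" if t: "(U, \<Phi>) \<in> trivs A" for U \<Phi> u
  proof -
    note M = bundle_manifold[OF vb] triv_open[OF vb t]
    obtain B :: "'f set" where B: "orthonormal_basis B" using exists_model_basis[OF vb] .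
    have li: "linear (\<lambda>u. u \<bullet> b)" for b :: 'f
      by (intro bounded_linear.linear bounded_linear_inner_left)
    have e: "\<Phi> x (?N x (frame A \<Phi> u x)) = (\<Sum>c\<in>B. (\<Sum>b\<in>B. \<omega>' x (frame A \<Phi> u x) (frame A \<Phi> b x) *
        \<pi> x (coframe A \<Phi> (\<lambda>u. u \<bullet> b) x) (coframe A \<Phi> (\<lambda>u. u \<bullet> c) x)) *\<^sub>R c)" if x: "x \<in> U" for x
    proof -
      note f = frame_in_fibre[OF vb t x]
      have fd: "flat A \<omega>' x (frame A \<Phi> u x) \<in> dual_fibre A x" by (rule flat_dual[OF vb tf(2) f])
      have "\<Phi> x (?N x (frame A \<Phi> u x)) \<bullet> c = (\<Sum>b\<in>B. \<omega>' x (frame A \<Phi> u x) (frame A \<Phi> b x) *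
        \<pi> x (coframe A \<Phi> (\<lambda>u. u \<bullet> b) x) (coframe A \<Phi> (\<lambda>u. u \<bullet> c) x))" for c
      proof -
        have cd: "coframe A \<Phi> (\<lambda>u. u \<bullet> c) x \<in> dual_fibre A x" by (rule coframe_dual[OF vb t x li])
        have "\<Phi> x (?N x (frame A \<Phi> u x)) \<bullet> c = coframe A \<Phi> (\<lambda>u. u \<bullet> c) x (?N x (frame A \<Phi> u x))"
          using coframe_apply[OF vb mem[OF f]] by simp
        also have "\<dots> = \<pi> x (flat A \<omega>' x (frame A \<Phi> u x)) (coframe A \<Phi> (\<lambda>u. u \<bullet> c) x)"
          using sharp_apply[OF vb bv fd] cd by blast
        finally show ?thesis
          unfolding bivector_expansion[OF vb t x B bv fd cd] by (simp add: flat_def f)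
      qed
      moreover have "\<Phi> x (?N x (frame A \<Phi> u x)) = (\<Sum>c\<in>B. (\<Phi> x (?N x (frame A \<Phi> u x)) \<bullet> c) *\<^sub>R c)"
        using B unfolding orthonormal_basis_def by simp
      ultimately show ?thesis by simp
    qed
    have "smooth_map_on A U (\<lambda>x. \<omega>' x (frame A \<Phi> u x) (frame A \<Phi> b x))" for b
      using tf(2) t unfolding two_form_def by fast
    moreover have "smooth_map_on A U (\<lambda>x. \<pi> x (coframe A \<Phi> (\<lambda>u. u \<bullet> b) x) (coframe A \<Phi> (\<lambda>u. u \<bullet> c) x))" for b c
      using bv t li unfolding bivector_def by fast
    ultimately have s: "smooth_map_on A U (\<lambda>x. \<Sum>c\<in>B. (\<Sum>b\<in>B. \<omega>' x (frame A \<Phi> u x) (frame A \<Phi> b x) *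
        \<pi> x (coframe A \<Phi> (\<lambda>u. u \<bullet> b) x) (coframe A \<Phi> (\<lambda>u. u \<bullet> c) x)) *\<^sub>R c)"
      by (intro smooth_map_on_sum[OF M] smooth_map_on_scaleR[OF M] smooth_map_on_mult[OF M]
          smooth_map_on_const)
    show ?thesis by (rule smooth_map_on_cong[OF M _ s]) (rule e[symmetric])
  qed
  then show ?thesis using lin mem unfolding bundle_endo_def by auto
qed

end

section \<open>Nijenhuis torsion\<close>

context
  fixes A :: "('m::{t2_space,second_countable_topology}, 'e::real_inner, 'v::real_vector,
      'f::real_inner, 'z) lie_algebroid_data_scheme"
  assumes A: "lie_algebroid A"
begin

lemma bracket_section: "X \<in> sections A \<Longrightarrow> Y \<in> sections A \<Longrightarrow> bracket A X Y \<in> sections A"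
  using A unfolding lie_algebroid_def by blast

lemma anchor_scale:
  assumes "v \<in> fibre A x" "f \<in> smooth_functions A"
  shows "anchor A x v (\<lambda>y. c * f y) = c * anchor A x v f"
proof -
  have "tangent_vector A x (anchor A x v)"
    using A assms(1) unfolding lie_algebroid_def anchor_map_def by blast
  then show ?thesis using assms(2) unfolding tangent_vector_def by blast
qed

text \<open>With \<open>\<omega>' = \<omega>(N \<cdot>, \<cdot>)\<close> and \<open>\<omega>'' = \<omega>(N\<^sup>2 \<cdot>, \<cdot>) = s \<omega>\<close> one has
  \<open>\<omega>(\<T>N(X, Y), Z) = d\<omega>'(NX, Y, Z) + d\<omega>'(X, NY, Z) - d\<omega>(NX, NY, Z) - d\<omega>''(X, Y, Z)\<close>.\<close>

lemma torsion_eq_0: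
  assumes cl: "closed_two_form A \<omega>" "closed_two_form A \<omega>'" and nd: "nondegenerate A \<omega>"
    and N: "bundle_endo A N" "squares_to A s N"
    and rel: "\<And>x v w. v \<in> fibre A x \<Longrightarrow> w \<in> fibre A x \<Longrightarrow> \<omega> x (N x v) w = \<omega>' x v w"
    and X: "X \<in> sections A" and Y: "Y \<in> sections A"
  shows "torsion A N X Y x = 0"
proof -
  note vb = lie_algebroid_bundle[OF A]
  have tf: "two_form A \<omega>" "two_form A \<omega>'" using cl unfolding closed_two_form_def by blast+
  have Nf: "N x v \<in> fibre A x" if "v \<in> fibre A x" for x v
    using N(1) that unfolding bundle_endo_def by blast
  have sq: "N x (N x v) = s *\<^sub>R v" if "v \<in> fibre A x" for x v
    using N(2) that unfolding squares_to_def by blast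
  \<comment> \<open>Skew-symmetry of \<open>\<omega>'\<close> makes \<open>N\<close> self-adjoint
    for \<open>\<omega>\<close>.\<close>
  have sym: "\<omega> x v (N x w) = \<omega>' x v w" if "v \<in> fibre A x" "w \<in> fibre A x" for x v w
    using two_form_skew[OF vb tf(1) that(1) Nf[OF that(2)]] two_form_skew[OF vb tf(2) that(2,1)]
      rel[OF that(2,1)] by simp
  \<comment> \<open>Here \<open>N\<close> squaring to the scalar \<open>s\<close> closes the
    sequence of forms: the next one after \<open>\<omega>'\<close> is a multiple of
    \<open>\<omega>\<close>.\<close>
  have s1: "\<omega>' x (N x v) w = s * \<omega> x v w" if "v \<in> fibre A x" "w \<in> fibre A x" for x v w
  proof -
    have "\<omega>' x (N x v) w = \<omega> x (s *\<^sub>R v) w" using rel[OF Nf[OF that(1)] that(2)] sq[OF that(1)] by simp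
    then show ?thesis using linear_on_two_form(1)[OF vb tf(1) that(2)] that(1) unfolding linear_on_def by simp
  qed
  have s2: "\<omega>' x v (N x w) = s * \<omega> x v w" if "v \<in> fibre A x" "w \<in> fibre A x" for x v w
    using two_form_skew[OF vb tf(2) that(1) Nf[OF that(2)]] two_form_skew[OF vb tf(1) that(2,1)]
      s1[OF that(2,1)] by simp
  define NX where "NX = (\<lambda>y. N y (X y))"
  define NY where "NY = (\<lambda>y. N y (Y y))"
  have NXY: "NX \<in> sections A" "NY \<in> sections A"
    unfolding NX_def NY_def using endo_section[OF vb N(1)] X Y by blast+
  note sf = section_in_fibre[OF vb]
  note br = sf[OF bracket_section]
  have T: "torsion A N X Y x = bracket A NX NY x -
      N x (bracket A NX Y x + bracket A X NY x - N x (bracket A X Y x))"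
    unfolding torsion_def NX_def NY_def ..
  have Tf: "torsion A N X Y x \<in> fibre A x"
    unfolding T by (intro fibre_closed[OF vb] Nf br NXY X Y)
  have "\<omega> x (torsion A N X Y x) w = 0" if w: "w \<in> fibre A x" for w
  proof -
    \<comment> \<open>The differential takes sections, so the test vector \<open>w\<close> is
      extended to one.\<close>
    obtain Z where Z: "Z \<in> sections A" "Z x = w" using section_through[OF vb w] .
    have d: "d_two_form A \<omega>' NX Y Z x = 0" "d_two_form A \<omega>' X NY Z x = 0"
      "d_two_form A \<omega> NX NY Z x = 0" "d_two_form A \<omega> X Y Z x = 0"
      using cl NXY X Y Z(1) unfolding closed_two_form_def by blast+
    note mem = sf[OF X] sf[OF Y] sf[OF Z(1)] sf[OF NXY(1)] sf[OF NXY(2)]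
    have fn: "\<omega>' y (NX y) v = s * \<omega> y (X y) v" "\<omega>' y (NY y) v = s * \<omega> y (Y y) v"
      "\<omega>' y v (NX y) = s * \<omega> y v (X y)" "\<omega>' y v (NY y) = s * \<omega> y v (Y y)"
      "\<omega> y (NX y) v = \<omega>' y (X y) v" "\<omega> y (NY y) v = \<omega>' y (Y y) v"
      "\<omega> y v (NX y) = \<omega>' y v (X y)" "\<omega> y v (NY y) = \<omega>' y v (Y y)" if "v \<in> fibre A y" for y v
      using that mem by (simp_all add: NX_def NY_def rel sym s1 s2)
    have an: "anchor A x v (\<lambda>y. s * \<omega> y (P y) (Q y)) = s * anchor A x v (\<lambda>y. \<omega> y (P y) (Q y))"
      if "v \<in> fibre A x" "P \<in> sections A" "Q \<in> sections A" for v P Q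
      by (rule anchor_scale[OF that(1) two_form_smooth_function[OF vb tf(1) that(2,3)]])
    \<comment> \<open>After rewriting with \<open>fn\<close>, the anchor terms and the brackets with
      \<open>Z\<close> cancel in pairs; what is left are the brackets occurring in the
      torsion.\<close>
    have "\<omega> x (bracket A NX NY x) w - \<omega>' x (bracket A NX Y x) w - \<omega>' x (bracket A X NY x) w
        + s * \<omega> x (bracket A X Y x) w =
      d_two_form A \<omega>' NX Y Z x + d_two_form A \<omega>' X NY Z x - d_two_form A \<omega> NX NY Z x
        - s * d_two_form A \<omega> X Y Z x"
      unfolding d_two_form_def
      by (simp add: fn an mem br X Y Z NXY w algebra_simps)
    moreover have "\<omega> x (torsion A N X Y x) w =
        \<omega> x (bracket A NX NY x) w - \<omega>' x (bracket A NX Y x) w - \<omega>' x (bracket A X NY x) w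
        + s * \<omega> x (bracket A X Y x) w"
    proof -
      note sub = linear_on_diff[OF subspace_fibre[OF vb] linear_on_two_form(1)[OF vb _ w]]
      let ?b = "bracket A NX Y x" and ?c = "bracket A X NY x" and ?e = "N x (bracket A X Y x)"
      have m: "bracket A NX NY x \<in> fibre A x" "?b \<in> fibre A x" "?c \<in> fibre A x" "?e \<in> fibre A x"
        "?b + ?c \<in> fibre A x" "?b + ?c - ?e \<in> fibre A x"
        by (intro fibre_closed[OF vb] Nf br NXY X Y)+
      have "\<omega> x (torsion A N X Y x) w = \<omega> x (bracket A NX NY x) w - \<omega>' x (?b + ?c - ?e) w"
        unfolding T sub[OF tf(1) m(1) Nf[OF m(6)]] rel[OF m(6) w] ..
      also have "\<omega>' x (?b + ?c - ?e) w = \<omega>' x (?b + ?c) w - \<omega>' x ?e w"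
        by (rule sub[OF tf(2) m(5,4)])
      also have "\<omega>' x (?b + ?c) w = \<omega>' x ?b w + \<omega>' x ?c w"
        using linear_on_two_form(1)[OF vb tf(2) w] m(2,3) unfolding linear_on_def by blast
      also have "\<omega>' x ?e w = s * \<omega> x (bracket A X Y x) w" by (rule s1[OF br[OF X Y] w])
      finally show ?thesis by simp
    qed
    ultimately show ?thesis using d by simp
  qed
  then show ?thesis using nd Tf unfolding nondegenerate_def by blast
qed

text \<open>Composing the metric with a transition tensor yields a scalar multiple of one of the
  given forms, which is closed by this lemma.\<close>

lemma closed_two_form_scale:
  assumes "closed_two_form A \<omega>"
  shows "closed_two_form A (\<lambda>x v w. c * \<omega> x v w)"
proof -
  note vb = lie_algebroid_bundle[OF A]
  have tf: "two_form A \<omega>" using assms unfolding closed_two_form_def by blast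
  have "two_form A (\<lambda>x v w. c * \<omega> x v w)"
    unfolding two_form_def
  proof (intro conjI allI ballI, goal_cases)
    case (1 x v)
    then show ?case
      using linear_on_two_form(1)[OF vb tf 1] unfolding linear_on_def by (simp add: algebra_simps)
  next
    case (2 x v u)
    then show ?case using two_form_skew[OF vb tf 2(2,1)] by simp
  next
    case (3 p)
    obtain U \<Phi> where p: "p = (U, \<Phi>)" and t: "(U, \<Phi>) \<in> trivs A" using 3 by (cases p) auto
    have "smooth_map_on A U (\<lambda>x. \<omega> x (frame A \<Phi> u x) (frame A \<Phi> w x))" for u w
      using tf t unfolding two_form_def by fast
    then show ?case
      unfolding p
      by (auto intro!: smooth_map_on_mult[OF bundle_manifold[OF vb] triv_open[OF vb t]]
          smooth_map_on_const)
  qed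
  moreover have "d_two_form A (\<lambda>x v w. c * \<omega> x v w) X Y Z x = c * d_two_form A \<omega> X Y Z x"
    if "X \<in> sections A" "Y \<in> sections A" "Z \<in> sections A" for X Y Z x
  proof -
    have "anchor A x v (\<lambda>y. c * \<omega> y (P y) (Q y)) = c * anchor A x v (\<lambda>y. \<omega> y (P y) (Q y))"
      if "v \<in> fibre A x" "P \<in> sections A" "Q \<in> sections A" for v P Q
      by (rule anchor_scale[OF that(1) two_form_smooth_function[OF vb tf that(2,3)]])
    then show ?thesis
      unfolding d_two_form_def using that section_in_fibre[OF vb] by (simp add: algebra_simps)
  qed
  ultimately show ?thesis using assms unfolding closed_two_form_def by simp
qed

end

section \<open>Hypersymplectic and hyper-Kaehler triples\<close>

lemma index_arith: "(1::3) - 1 = 3" "(1::3) + 1 = 2" "(2::3) - 1 = 1" "(2::3) + 1 = 3"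
  "(3::3) - 1 = 2" "(3::3) + 1 = 1"
  by simp_all

text \<open>Both sign patterns have the shape \<open>(s, s, - 1)\<close>: \<open>s = - 1\<close> is
  the hyper case and \<open>s = 1\<close> the para-hyper case. The computations use only
  \<open>s * s = 1\<close>.\<close>

lemma hypersymplectic_iff_hyperkahler:
  fixes A :: "('m::{t2_space,second_countable_topology}, 'e::real_inner, 'v::real_vector,
      'f::real_inner, 'z) lie_algebroid_data_scheme"
  assumes A: "lie_algebroid A" and \<omega>: "\<And>i. symplectic A (\<omega> i)"
    and \<pi>: "\<And>i. inverse_bivector A (\<omega> i) (\<pi> i)"
    and s: "s * s = (1::real)" and e: "\<epsilon> 1 = s" "\<epsilon> 2 = s" "\<epsilon> 3 = - 1"
  shows "hypersymplectic_sgn A \<epsilon> \<omega> \<pi> \<longleftrightarrow>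
    hyperkahler_sgn A s (metric_flat A \<epsilon> \<omega> \<pi>)
      (transition A \<omega> \<pi> 1) (transition A \<omega> \<pi> 2) (transition A \<omega> \<pi> 3)"
proof -
  note vb = lie_algebroid_bundle[OF A]
  have cl: "closed_two_form A (\<omega> i)" and tf: "two_form A (\<omega> i)" and nd: "nondegenerate A (\<omega> i)" for i
    using \<omega>[of i] unfolding symplectic_def closed_two_form_def by blast+
  define N1 where "N1 = transition A \<omega> \<pi> 1"
  define N2 where "N2 = transition A \<omega> \<pi> 2"
  define N3 where "N3 = transition A \<omega> \<pi> 3"
  have t: "transition A \<omega> \<pi> i = (\<lambda>x v. sharp A (\<pi> (i - 1)) x (flat A (\<omega> (i + 1)) x v))" for i
    by (intro HOL.ext) (simp add: transition_def)
  note sf = A \<omega> \<omega> \<pi>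
  have endo: "bundle_endo A N1" "bundle_endo A N2" "bundle_endo A N3"
    unfolding N1_def N2_def N3_def t by (rule sharp_flat_endo[OF sf])+
  have mem: "N1 x v \<in> fibre A x" "N2 x v \<in> fibre A x" "N3 x v \<in> fibre A x" if "v \<in> fibre A x" for x v
    using endo that unfolding bundle_endo_def by blast+
  have lin: "linear_on (fibre A x) (N1 x)" "linear_on (fibre A x) (N2 x)" "linear_on (fibre A x) (N3 x)"
    for x
    using endo unfolding bundle_endo_def by blast+
  have Nsc: "N1 x (c *\<^sub>R v) = c *\<^sub>R N1 x v" "N2 x (c *\<^sub>R v) = c *\<^sub>R N2 x v"
    "N3 x (c *\<^sub>R v) = c *\<^sub>R N3 x v" if "v \<in> fibre A x" for x v c
    using lin[of x] that unfolding linear_on_def by blast+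
  have Nmin: "N1 x (- v) = - N1 x v" "N2 x (- v) = - N2 x v" "N3 x (- v) = - N3 x v"
    if "v \<in> fibre A x" for x v
    using Nsc[OF that, of "- 1"] by simp_all
  have rel: "\<omega> 3 x (N1 x v) w = \<omega> 2 x v w" "\<omega> 1 x (N2 x v) w = \<omega> 3 x v w"
    "\<omega> 2 x (N3 x v) w = \<omega> 1 x v w" if "v \<in> fibre A x" "w \<in> fibre A x" for x v w
    unfolding N1_def N2_def N3_def t index_arith by (rule sharp_flat_eq[OF sf that])+
  have osc: "\<omega> i x (c *\<^sub>R v) w = c * \<omega> i x v w" if "v \<in> fibre A x" "w \<in> fibre A x" for i x v w c
    using linear_on_two_form(1)[OF vb tf that(2)] that(1) unfolding linear_on_def by simp
  have omin: "\<omega> i x (- v) w = - \<omega> i x v w" if "v \<in> fibre A x" "w \<in> fibre A x" for i x v w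
    using osc[OF that, of i "- 1"] by simp
  have skew: "\<omega> i x v w = - \<omega> i x w v" if "v \<in> fibre A x" "w \<in> fibre A x" for i x v w
    by (rule two_form_skew[OF vb tf that])
  have ext: "v = w" if "v \<in> fibre A x" "w \<in> fibre A x" "\<And>u. u \<in> fibre A x \<Longrightarrow> \<omega> i x v u = \<omega> i x w u"
    for i x v w
    by (rule nondegenerate_ext[OF vb tf nd that])
  note fc = fibre_closed[OF vb]
  \<comment> \<open>The symplectic and inverse conditions hold by assumption, leaving only the three
    squares.\<close>
  have hs: "hypersymplectic_sgn A \<epsilon> \<omega> \<pi> \<longleftrightarrow>
      squares_to A s N1 \<and> squares_to A s N2 \<and> squares_to A (- 1) N3"
    unfolding hypersymplectic_sgn_def forall_3 N1_def N2_def N3_def e using \<omega> \<pi> by blast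
  define g where "g = metric_flat A \<epsilon> \<omega> \<pi>"
  have "hyperkahler_sgn A s g N1 N2 N3"
    if "squares_to A s N1" "squares_to A s N2" "squares_to A (- 1) N3"
  proof -
    have sq: "N1 x (N1 x v) = s *\<^sub>R v" "N2 x (N2 x v) = s *\<^sub>R v" "N3 x (N3 x v) = - v"
      if "v \<in> fibre A x" for x v
      using \<open>squares_to A s N1\<close> \<open>squares_to A s N2\<close> \<open>squares_to A (- 1) N3\<close> that
      unfolding squares_to_def by simp_all
    \<comment> \<open>Pairing with \<open>\<omega> 1\<close> and applying \<open>rel\<close> runs
      through \<open>\<omega> 3\<close> and \<open>\<omega> 2\<close> back to
      \<open>\<omega> 1\<close>.\<close>
    have cyc: "N2 x (N1 x (N3 x v)) = v" if v: "v \<in> fibre A x" for x v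
      by (rule ext[where i = 1 and x = x]) (simp_all add: v mem rel)
    have N3: "N3 x v = N1 x (N2 x v)" if v: "v \<in> fibre A x" for x v
    proof -
      have "N1 x (N2 x v) = N1 x (N2 x (N2 x (N1 x (N3 x v))))" by (simp only: cyc[OF v])
      also have "\<dots> = N3 x v" by (simp add: sq mem v Nsc s)
      finally show ?thesis ..
    qed
    have anti: "N2 x (N1 x v) = - N1 x (N2 x v)" if v: "v \<in> fibre A x" for x v
    proof -
      \<comment> \<open>The squares of \<open>N1\<close> and \<open>N2\<close> reduce the left side
        to \<open>s * s\<close> times \<open>N2 N1 v\<close>; the square of \<open>N3\<close>
        reduces the right side to \<open>- N1 N2 v\<close>.\<close>
      have "N1 x (N1 x (N2 x (N1 x (N2 x (N2 x v))))) = N1 x (N3 x (N3 x (N2 x v)))"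
        by (simp add: N3 mem v)
      then show ?thesis by (simp add: sq mem v Nsc Nmin fc s)
    qed
    \<comment> \<open>The tensor inside \<open>metric_flat\<close> inverts \<open>N3\<close>, and
      \<open>N3\<close> squares to -1.\<close>
    have P: "sharp A (\<pi> 1) x (flat A (\<omega> 2) x v) = - N3 x v" if v: "v \<in> fibre A x" for x v
    proof (rule ext[where i = 1 and x = x])
      show "sharp A (\<pi> 1) x (flat A (\<omega> 2) x v) \<in> fibre A x" by (rule sharp_flat_in_fibre[OF sf v])
      show "- N3 x v \<in> fibre A x" by (intro fc mem v)
      fix u assume u: "u \<in> fibre A x"
      have "\<omega> 1 x (N3 x v) u = \<omega> 2 x (N3 x (N3 x v)) u" by (simp add: rel mem u v)
      then show "\<omega> 1 x (sharp A (\<pi> 1) x (flat A (\<omega> 2) x v)) u = \<omega> 1 x (- N3 x v) u"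
        by (simp add: sharp_flat_eq[OF sf v u] sq omin mem u v)
    qed
    \<comment> \<open>The prefactor \<open>\<epsilon> 3 * \<epsilon> 2\<close> is
      \<open>- s\<close>; the minus sign of \<open>P\<close> turns it into \<open>s\<close>.\<close>
    have g: "g x v w = s * \<omega> 3 x (N3 x v) w" if "v \<in> fibre A x" "w \<in> fibre A x" for x v w
      unfolding g_def metric_flat_def P[OF that(1)] e using that by (simp add: flat_def omin mem)
    have g_out: "g x v w = 0" if "w \<notin> fibre A x" for x v w
      using that by (simp add: g_def metric_flat_def flat_def)
    have g1: "g x (N1 x v) w = - s * \<omega> 1 x v w" if "v \<in> fibre A x" "w \<in> fibre A x" for x v w
    proof -
      have "N3 x (N1 x v) = - s *\<^sub>R N2 x v" using that by (simp add: N3 anti mem Nmin sq)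
      moreover have "\<omega> 3 x (N2 x v) w = \<omega> 1 x (N2 x (N2 x v)) w" using that by (simp add: rel mem)
      then have "\<omega> 3 x (N2 x v) w = s * \<omega> 1 x v w" using that by (simp add: sq osc)
      ultimately show ?thesis using that s by (simp add: g mem osc omin fc)
    qed
    have g2: "g x (N2 x v) w = \<omega> 2 x v w" if "v \<in> fibre A x" "w \<in> fibre A x" for x v w
    proof -
      have "N3 x (N2 x v) = s *\<^sub>R N1 x v" using that by (simp add: N3 mem sq Nsc)
      then show ?thesis using that s by (simp add: g mem osc rel flip: mult.assoc)
    qed
    have g3: "g x (N3 x v) w = - s * \<omega> 3 x v w" if "v \<in> fibre A x" "w \<in> fibre A x" for x v w
      using that by (simp add: g mem sq omin)
    \<comment> \<open>Self-adjointness for \<open>\<omega> 3\<close>, because composing it with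
      \<open>N1\<close> gives the skew form \<open>\<omega> 2\<close>; for \<open>N2\<close> below
      the composite is \<open>s\<close> times \<open>\<omega> 1\<close>.\<close>
    have sa1: "\<omega> 3 x (N1 x v) w = \<omega> 3 x v (N1 x w)" if "v \<in> fibre A x" "w \<in> fibre A x" for x v w
      using that skew[of v x "N1 x w" 3] skew[of v x w 2] by (simp add: rel mem)
    have o32: "\<omega> 3 x (N2 x v) w = s * \<omega> 1 x v w" if "v \<in> fibre A x" "w \<in> fibre A x" for x v w
    proof -
      have "\<omega> 3 x (N2 x v) w = \<omega> 1 x (N2 x (N2 x v)) w" using that by (simp add: rel mem)
      then show ?thesis using that by (simp add: sq osc)
    qed
    have sa2: "\<omega> 3 x (N2 x v) w = \<omega> 3 x v (N2 x w)" if "v \<in> fibre A x" "w \<in> fibre A x" for x v w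
      using that skew[of v x "N2 x w" 3] skew[of v x w 1] by (simp add: o32 mem)
    \<comment> \<open>Moving \<open>N1 N2\<close> to the other argument reverses the product; the
      sign from anticommutation cancels that of the skew form.\<close>
    have g_sym: "g x v w = g x w v" if "v \<in> fibre A x" "w \<in> fibre A x" for x v w
    proof -
      have "\<omega> 3 x (N3 x v) w = \<omega> 3 x v (N2 x (N1 x w))" using that by (simp add: N3 sa1 sa2 mem)
      also have "\<dots> = - \<omega> 3 x (- N3 x w) v"
        using that skew[of v x "N2 x (N1 x w)" 3] by (simp add: anti N3 mem fc)
      finally show ?thesis using that by (simp add: g omin mem)
    qed
    have gsc: "g x (c *\<^sub>R v) w = c * g x v w" if "v \<in> fibre A x" "w \<in> fibre A x" for x v w c
      using that by (simp add: g Nsc osc mem fc)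
    have "dual_map A g"
      unfolding dual_map_def
    proof (intro conjI allI ballI, goal_cases)
      case (1 x v)
      then show ?case
        using dual_scale[OF vb flat_dual[OF vb tf[of 3] sharp_flat_in_fibre[OF sf 1]]]
        unfolding g_def metric_flat_def by blast
    next
      case (2 x w)
      then show ?case
        using linear_on_two_form(1)[OF vb tf 2, of 3] lin(3)[of x] mem fc
        unfolding linear_on_def by (simp add: g algebra_simps)
    next
      case (3 p)
      obtain U \<Phi> where p: "p = (U, \<Phi>)" and t: "(U, \<Phi>) \<in> trivs A" using 3 by (cases p) auto
      note M = bundle_manifold[OF vb] triv_open[OF vb t]
      note f = frame_in_fibre[OF vb t]
      have "smooth_map_on A U (\<lambda>x. g x (frame A \<Phi> u x) (frame A \<Phi> w x))" for u w
      proof -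
        have c: "smooth_map_on A U (\<lambda>x. \<Phi> x (frame A \<Phi> w x))"
          by (rule smooth_map_on_cong[OF M _ smooth_map_on_const[of _ _ w]]) (simp add: triv_frame[OF vb t])
        have n: "smooth_map_on A U (\<lambda>x. \<Phi> x (N3 x (frame A \<Phi> u x)))"
          using endo(3) t unfolding bundle_endo_def by fast
        have "smooth_map_on A U (\<lambda>x. \<omega> 3 x (N3 x (frame A \<Phi> u x)) (frame A \<Phi> w x))"
          by (rule smooth_map_on_two_form[OF vb tf t mem(3)[OF f] n f c])
        then have "smooth_map_on A U (\<lambda>x. s * \<omega> 3 x (N3 x (frame A \<Phi> u x)) (frame A \<Phi> w x))"
          by (rule smooth_map_on_mult[OF M smooth_map_on_const])
        then show ?thesis by (rule smooth_map_on_cong[OF M, rotated]) (simp add: g f)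
      qed
      then show ?case by (simp add: p)
    qed
    moreover have "nondegenerate A g"
      unfolding nondegenerate_def
    proof (intro allI ballI impI)
      fix x v assume v: "v \<in> fibre A x" and 0: "\<forall>w\<in>fibre A x. g x v w = 0"
      have "s \<noteq> 0" using s by auto
      \<comment> \<open>Nondegeneracy passes from \<open>\<omega> 3\<close> to \<open>g\<close>
        because \<open>N3\<close> is injective.\<close>
      then have "\<forall>w\<in>fibre A x. \<omega> 3 x (N3 x v) w = 0" using 0 v by (simp add: g)
      then have "N3 x v = 0" using nd[of 3] mem(3)[OF v] unfolding nondegenerate_def by blast
      then show "v = 0" using sq(3)[OF v] Nsc(3)[OF v, of 0] by simp
    qed
    ultimately have "pseudo_metric A g" using g_sym unfolding pseudo_metric_def by blast
    moreover have "complex_tensor A s N1"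
      unfolding complex_tensor_def
      using endo(1) \<open>squares_to A s N1\<close> torsion_eq_0[OF A cl cl nd endo(1) \<open>squares_to A s N1\<close> rel(1)]
      by blast
    moreover have "complex_tensor A s N2"
      unfolding complex_tensor_def
      using endo(2) \<open>squares_to A s N2\<close> torsion_eq_0[OF A cl cl nd endo(2) \<open>squares_to A s N2\<close> rel(2)]
      by blast
    \<comment> \<open>Both sides reduce to multiples of \<open>\<omega> 1 x v (N1 x w)\<close>: the
      left by \<open>g1\<close>, the right by symmetry of \<open>g\<close> and then
      \<open>g1\<close>, with one sign from skew-symmetry.\<close>
    moreover have "g x (N1 x v) (N1 x w) = - g x v (N1 x (N1 x w))"
      if "v \<in> fibre A x" "w \<in> fibre A x" for x v w
    proof -
      have "g x v (N1 x (N1 x w)) = s * \<omega> 1 x v (N1 x w)"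
        using that g_sym[of v x "N1 x (N1 x w)"] skew[of v x "N1 x w" 1] by (simp add: g1 mem)
      then show ?thesis using that by (simp add: g1 mem)
    qed
    moreover have "g x (N2 x v) (N2 x w) = - g x v (N2 x (N2 x w))"
      if "v \<in> fibre A x" "w \<in> fibre A x" for x v w
      using that g_sym[of v x "N2 x (N2 x w)"] skew[of v x "N2 x w" 2] by (simp add: g2 mem)
    ultimately have "hermitian A s g N1" "hermitian A s g N2"
      using section_in_fibre[OF vb] unfolding hermitian_def by blast+
    moreover have "\<exists>\<eta>. closed_two_form A \<eta> \<and> (\<forall>x. \<forall>v\<in>fibre A x. g x (J x v) = flat A \<eta> x v)"
      if "J \<in> {N1, N2, N3}" for J
    proof -
      \<comment> \<open>The witness is the multiple \<open>c\<close> of \<open>\<omega> i\<close>;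
        \<open>g_out\<close> supplies equality off the fibre, where \<open>flat\<close> is 0. For
        \<open>N2\<close> the factor is 1.\<close>
      have *: "\<exists>\<eta>. closed_two_form A \<eta> \<and> (\<forall>x. \<forall>v\<in>fibre A x. g x (K x v) = flat A \<eta> x v)"
        if "\<And>x v w. v \<in> fibre A x \<Longrightarrow> w \<in> fibre A x \<Longrightarrow> g x (K x v) w = c * \<omega> i x v w" for K c i
        using that
        by (intro exI[of _ "\<lambda>x v w. c * \<omega> i x v w"] conjI closed_two_form_scale[OF A cl])
           (auto simp: flat_def g_out)
      show ?thesis
        using that *[of N1, OF g1] *[of N2 1 2] g2 *[of N3, OF g3] by auto
    qed
    ultimately show ?thesis using N3 anti unfolding hyperkahler_sgn_def by simp
  qed
  moreover have "squares_to A s N1 \<and> squares_to A s N2 \<and> squares_to A (- 1) N3"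
    if hk: "hyperkahler_sgn A s g N1 N2 N3"
  proof -
    have q: "squares_to A s N1" "squares_to A s N2"
      using hk unfolding hyperkahler_sgn_def hermitian_def complex_tensor_def by blast+
    have sq: "N1 x (N1 x v) = s *\<^sub>R v" "N2 x (N2 x v) = s *\<^sub>R v" if "v \<in> fibre A x" for x v
      using q that unfolding squares_to_def by blast+
    have anti: "N2 x (N1 x v) = - N1 x (N2 x v)" and N3: "N3 x v = N1 x (N2 x v)"
      if "v \<in> fibre A x" for x v
      using hk that unfolding hyperkahler_sgn_def by simp_all
    \<comment> \<open>The square of \<open>N1 N2\<close> is minus the product of the two squares,
      that is \<open>- s * s\<close>.\<close>
    have "N3 x (N3 x v) = - v" if v: "v \<in> fibre A x" for x v
      by (simp add: N3 anti sq Nsc Nmin mem fc v s)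
    then show ?thesis using q unfolding squares_to_def by simp
  qed
  ultimately show ?thesis unfolding hs g_def N1_def N2_def N3_def by blast
qed

theorem theorem6p6:
  fixes A :: "('m::{t2_space,second_countable_topology}, 'e::real_inner, 'v::real_vector, 'f::real_inner)
      lie_algebroid_data"
    and \<omega> :: "3 \<Rightarrow> 'm \<Rightarrow> 'v \<Rightarrow> 'v \<Rightarrow> real"
    and \<pi> :: "3 \<Rightarrow> 'm \<Rightarrow> ('v \<Rightarrow> real) \<Rightarrow> ('v \<Rightarrow> real) \<Rightarrow> real"
  assumes "lie_algebroid A"
    and "\<And>i. symplectic A (\<omega> i)"
    and "\<And>i. inverse_bivector A (\<omega> i) (\<pi> i)"
  shows "(hypersymplectic A \<omega> \<pi> \<longleftrightarrow>
            hyperkahler A (metric_flat A hyper_sgn \<omega> \<pi>)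
              (transition A \<omega> \<pi> 1) (transition A \<omega> \<pi> 2) (transition A \<omega> \<pi> 3)) \<and>
         (para_hypersymplectic A \<omega> \<pi> \<longleftrightarrow>
            para_hyperkahler A (metric_flat A para_hyper_sgn \<omega> \<pi>)
              (transition A \<omega> \<pi> 1) (transition A \<omega> \<pi> 2) (transition A \<omega> \<pi> 3))"
  using hypersymplectic_iff_hyperkahler[OF assms, of "- 1" hyper_sgn]
    hypersymplectic_iff_hyperkahler[OF assms, of 1 para_hyper_sgn]
  by (simp add: hyper_sgn_def para_hyper_sgn_def)

end
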